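(* Let $X$ be a non-trivial complex Banach space, and let $(A(t))_{t\in\mathbb{R}}$, the evolution system $U(\cdot,\cdot)$ generated by $A(\cdot)$, the projections $P(t)$, the constants $M',\omega>0$ and the Green's function $\Gamma(\cdot,\cdot)$ be as in the context. Suppose that $U(\cdot,\cdot)$ is exponentially stable, let $x\in P(0)X\cap\overline{D(A(0))}$, and let $F\in Q\text{-}AAP([0,\infty)\times X:X)$. Suppose that for each $\epsilon>0$ there exists a finite number $L(\epsilon)>0$ such that any interval $I'\subseteq[0,\infty)$ of length $L(\epsilon)$ contains at least one number $\tau\in I'$ for which there exists a finite number $M(\epsilon,\tau)>0$ such that $$\int_0^{+\infty}\bigl\|\Gamma(t+\tau,t+\tau-s)-\Gamma(t,t-s)\bigr\|\,ds\le\epsilon,\quad t\ge M(\epsilon,\tau).$$ If there exists a finite number $L\in(0,\omega/M')$ such that $\|F(t,y)-F(t,z)\|\le L\|y-z\|$ for all $y,z\in X$ and $t\ge0$, then there exists a unique mild solution $u(\cdot)$ of $u'(t)=A(t)u(t)+F(t,u(t))$, $t>0$; $u(0)=x$, belonging to the class $Q\text{-}AAP([0,\infty):X)$.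
   Context: Standing assumptions. $(A(t))_{t\in\mathbb{R}}$ is a family of closed linear operators on $X$ satisfying: (H1) (Acquistapace–Terreni conditions) there are $\omega_0\ge0$, $\phi\in(\pi/2,\pi)$ and $0<\mu,\nu\le1$ with $\mu+\nu>1$ such that $\overline{\Sigma_\phi}\subseteq\rho(A(t)-\omega_0)$, where $\Sigma_\phi=\{\lambda\in\mathbb{C}\setminus\{0\}:|\arg\lambda|<\phi\}$, and, with bounds uniform in $t,s\in\mathbb{R}$, $\lambda\in\overline{\Sigma_\phi}$: $\|R(\lambda:A(t)-\omega_0)\|=O((1+|\lambda|)^{-1})$ and $\|(A(t)-\omega_0)R(\lambda:A(t)-\omega_0)[R(\omega_0:A(t))-R(\omega_0:A(s))]\|=O(|t-s|^\mu|\lambda|^{-\nu})$. Here $R(\lambda:A)=(\lambda-A)^{-1}$ and $\rho(A)$ is the resolvent set. An evolution system is a family $\{U(t,s):t\ge s\}\subseteq L(X)$ with $U(s,s)=I$, $U(t,s)=U(t,r)U(r,s)$ for $t\ge r\ge s$, and $(t,s)\mapsto U(t,s)x$ continuous on $\{t>s\}$ for each $x\in X$. Under (H1) there is an evolution system $U(\cdot,\cdot)$ generated by $A(\cdot)$ (Acquistapace–Terreni). (H2) $U(\cdot,\cdot)$ is hyperbolic: there exist a uniformly bounded, strongly continuous family of projections $(P(t))_{t\in\mathbb{R}}\subseteq L(X)$ and constants $M',\omega>0$ such that, with $Q(t):=I-P(t)$: (a) $U(t,s)P(s)=P(t)U(t,s)$ for all $t\ge s$; (b) the restriction $U_Q(t,s):Q(s)X\to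 Q(t)X$ of $U(t,s)$ is invertible for all $t\ge s$, and one sets $U_Q(s,t)=U_Q(t,s)^{-1}$; (c) $\|U(t,s)P(s)\|\le M'e^{-\omega(t-s)}$ and $\|U_Q(s,t)Q(t)\|\le M'e^{-\omega(t-s)}$ for all $t\ge s$. $U(\cdot,\cdot)$ is exponentially stable if one can choose $P(t)=I$ for all $t\in\mathbb{R}$ in (H2); this choice is then made, so $Q(t)=0$ and $\|U(t,s)\|\le M'e^{-\omega(t-s)}$ for $t\ge s$. The Green's function is $\Gamma(t,s):=U(t,s)P(s)$ for $t\ge s$ and $\Gamma(t,s):=-U_Q(t,s)Q(s)$ for $t<s$ (so here $\Gamma(t,s)=U(t,s)$ for $t\ge s$ and $\Gamma(t,s)=0$ for $t<s$). A mild solution of $u'(t)=A(t)u(t)+F(t,u(t))$, $t>0$; $u(0)=x$ is a bounded continuous $u:[0,\infty)\to X$ with $u(t)=U(t,0)x+\int_0^tU(t,s)F(s,u(s))\,ds$, $t\ge0$. For $I=[0,\infty)$: $Q\text{-}AAP(I:X)$ (quasi-asymptotically almost periodic functions) is the set of bounded continuous $f:I\to X$ such that for each $\epsilon>0$ there exists a finite number $L(\epsilon)>0$ such that any interval $I'\subseteq I$ of length $L(\epsilon)$ contains at least one number $\tau\in I'$ for which there exists a finite number $M(\epsilon,\tau)>0$ with $\|f(t+\tau)-f(t)\|\le\epsilon$ for all $t\in I$ with $|t|\ge M(\epsilon,\tau)$. $Q\text{-}AAP(I\times X:X)$ is the set of continuous $F:I\times X\to X$ such that for each $\epsilon>0$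 there exists a finite number $L(\epsilon)>0$ such that any interval $I'\subseteq I$ of length $L(\epsilon)$ contains at least one number $\tau\in I'$ for which there exists a finite number $M(\epsilon,\tau)>0$ such that for each bounded subset $B$ of $X$: $\|F(t+\tau,x)-F(t,x)\|\le\epsilon$ for all $t\in I$, $x\in B$ with $|t|\ge M(\epsilon,\tau)$.
   Formalization: The formal theorem also assumes that t ↦ F(t,0) is bounded on [0,∞); without this the claim fails, e.g. X = ℂ, A(t) = −1, x = 0, F(t,y) = ln(1+t), where the only candidate solution is unbounded. *)

theory Defs
  imports "HOL-Analysis.Analysis"
begin

section \<open>Complex Banach spaces and operators\<close>

class complex_banach = banach +
  fixes scaleC :: "complex \<Rightarrow> 'a \<Rightarrow> 'a" (infixr \<open>*\<^sub>C\<close> 75)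
  assumes scaleC_add_right: "c *\<^sub>C (x + y) = c *\<^sub>C x + c *\<^sub>C y"
    and scaleC_add_left: "(c + d) *\<^sub>C x = c *\<^sub>C x + d *\<^sub>C x"
    and scaleC_scaleC: "c *\<^sub>C d *\<^sub>C x = (c * d) *\<^sub>C x"
    and scaleR_scaleC: "r *\<^sub>R x = complex_of_real r *\<^sub>C x"
    and norm_scaleC: "norm (c *\<^sub>C x) = cmod c * norm x"

text \<open>
  The complex algebra \<open>L(X)\<close> is represented by the elements of the (real) normed space
  \<open>'a \<Rightarrow>\<^sub>L 'a\<close> which commute with complex scalars. The operator norm is the same.
\<close>

definition clinear_op :: "('a::complex_banach \<Rightarrow>\<^sub>L 'a) \<Rightarrow> bool" where
  "clinear_op T \<longleftrightarrow> (\<forall>c x. T (c *\<^sub>C x) = c *\<^sub>C T x)"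

text \<open>
  An unbounded operator is given by its domain \<open>D\<close> and its action \<open>A\<close>; the values of
  \<open>A\<close> outside of \<open>D\<close> are irrelevant.
\<close>

definition closed_linear_operator :: "'a::complex_banach set \<Rightarrow> ('a \<Rightarrow> 'a) \<Rightarrow> bool" where
  "closed_linear_operator D A \<longleftrightarrow>
     0 \<in> D \<and>
     (\<forall>x\<in>D. \<forall>y\<in>D. x + y \<in> D \<and> A (x + y) = A x + A y) \<and>
     (\<forall>c. \<forall>x\<in>D. c *\<^sub>C x \<in> D \<and> A (c *\<^sub>C x) = c *\<^sub>C A x) \<and>
     closed {(x, A x) |x. x \<in> D}"

definition resolvent :: "'a::complex_banach set \<Rightarrow> ('a \<Rightarrow> 'a) \<Rightarrow> complex \<Rightarrow> 'a \<Rightarrow> 'a" where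
  "resolvent D A z = inv_into D (\<lambda>x. z *\<^sub>C x - A x)"

definition resolvent_set :: "'a::complex_banach set \<Rightarrow> ('a \<Rightarrow> 'a) \<Rightarrow> complex set" where
  "resolvent_set D A =
     {z. bij_betw (\<lambda>x. z *\<^sub>C x - A x) D UNIV \<and> bounded_linear (resolvent D A z)}"

definition shifted :: "('a::complex_banach \<Rightarrow> 'a) \<Rightarrow> real \<Rightarrow> 'a \<Rightarrow> 'a" where
  "shifted A w x = A x - complex_of_real w *\<^sub>C x"


section \<open>The Acquistapace--Terreni conditions\<close>

definition sector :: "real \<Rightarrow> complex set" where
  "sector \<phi> = {z. z \<noteq> 0 \<and> \<bar>Arg z\<bar> < \<phi>}"

text \<open>
  In the last clause \<open>z = 0\<close> is left out: there the bound \<open>|z|\<^sup>-\<^sup>\<nu>\<close> is \<open>+\<infinity>\<close>, whereas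
  \<open>0 powr (- \<nu>) = 0\<close> in the library. The operators under \<open>onorm\<close> are bounded
  (the second one because \<open>B (z - B)\<^sup>-\<^sup>1 = z (z - B)\<^sup>-\<^sup>1 - I\<close>).
\<close>

definition acquistapace_terreni ::
  "(real \<Rightarrow> 'a::complex_banach set) \<Rightarrow> (real \<Rightarrow> 'a \<Rightarrow> 'a) \<Rightarrow> real \<Rightarrow> real \<Rightarrow> real \<Rightarrow> real \<Rightarrow> bool"
where
  "acquistapace_terreni D A \<omega>\<^sub>0 \<phi> \<mu> \<nu> \<longleftrightarrow>
     0 \<le> \<omega>\<^sub>0 \<and> pi / 2 < \<phi> \<and> \<phi> < pi \<and> 0 < \<mu> \<and> \<mu> \<le> 1 \<and> 0 < \<nu> \<and> \<nu> \<le> 1 \<and> 1 < \<mu> + \<nu> \<and>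
     (\<forall>t. closure (sector \<phi>) \<subseteq> resolvent_set (D t) (shifted (A t) \<omega>\<^sub>0)) \<and>
     (\<exists>K. \<forall>t. \<forall>z\<in>closure (sector \<phi>).
        onorm (resolvent (D t) (shifted (A t) \<omega>\<^sub>0) z) \<le> K / (1 + cmod z)) \<and>
     (\<exists>K. \<forall>t s. \<forall>z\<in>closure (sector \<phi>) - {0}.
        onorm (\<lambda>x. shifted (A t) \<omega>\<^sub>0 (resolvent (D t) (shifted (A t) \<omega>\<^sub>0) z
                 (resolvent (D t) (A t) (complex_of_real \<omega>\<^sub>0) x
                  - resolvent (D s) (A s) (complex_of_real \<omega>\<^sub>0) x)))
          \<le> K * \<bar>t - s\<bar> powr \<mu> * cmod z powr (- \<nu>))"


section \<open>Evolution systems\<close>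

text \<open>Only the operators \<open>U t s\<close> with \<open>t \<ge> s\<close> are meaningful.\<close>

definition evolution_system :: "(real \<Rightarrow> real \<Rightarrow> 'a::complex_banach \<Rightarrow>\<^sub>L 'a) \<Rightarrow> bool" where
  "evolution_system U \<longleftrightarrow>
     (\<forall>t s. s \<le> t \<longrightarrow> clinear_op (U t s)) \<and>
     (\<forall>s. U s s = id_blinfun) \<and>
     (\<forall>t r s. s \<le> r \<and> r \<le> t \<longrightarrow> U t s = U t r o\<^sub>L U r s) \<and>
     (\<forall>x. continuous_on {(t, s). s < t} (\<lambda>(t, s). U t s x))"

text \<open>
  The evolution system that Acquistapace and Terreni construct from \<open>A(\<cdot>)\<close> is the solution
  operator of \<open>u' = A(t) u\<close>: for \<open>t > s\<close> it maps \<open>X\<close> into \<open>D(A(t))\<close>, is continuously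
  differentiable in \<open>t\<close> with respect to the operator norm with \<open>\<partial>\<^sub>t U(t,s) = A(t) U(t,s)\<close>,
  and satisfies \<open>\<parallel>A(t)\<^sup>k U(t,s)\<parallel> \<le> C (t - s)\<^sup>-\<^sup>k\<close> for \<open>0 < t - s \<le> 1\<close> and \<open>k = 0, 1\<close>.
  Since \<open>D(A(s))\<close> need not be dense, \<open>U(t,s) x \<rightarrow> x\<close> as \<open>t \<down> s\<close> holds only for \<open>x\<close> in the
  closure of \<open>D(A(s))\<close>. For the other \<open>x\<close> the initial value is attained in the weaker norm
  \<open>\<parallel>R(z : A(s)) x\<parallel>\<close>; without this last clause \<open>U\<close> would not be determined by \<open>A(\<cdot>)\<close>
  outside of the closure of the domain.
\<close>

definition generated_by ::
  "(real \<Rightarrow> real \<Rightarrow> 'a::complex_banach \<Rightarrow>\<^sub>L 'a) \<Rightarrow> (real \<Rightarrow> 'a set) \<Rightarrow> (real \<Rightarrow> 'a \<Rightarrow> 'a) \<Rightarrow> bool"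
where
  "generated_by U D A \<longleftrightarrow>
     (\<forall>t s. s < t \<longrightarrow> range (U t s) \<subseteq> D t) \<and>
     (\<exists>AU :: real \<Rightarrow> real \<Rightarrow> 'a \<Rightarrow>\<^sub>L 'a.
        (\<forall>t s x. s < t \<longrightarrow> blinfun_apply (AU t s) x = A t (U t s x)) \<and>
        (\<forall>s. continuous_on {s<..} (\<lambda>t. AU t s)) \<and>
        (\<forall>t s. s < t \<longrightarrow> ((\<lambda>r. U r s) has_vector_derivative AU t s) (at t)) \<and>
        (\<exists>C. \<forall>t s. s < t \<and> t \<le> s + 1 \<longrightarrow> norm (U t s) \<le> C \<and> norm (AU t s) \<le> C / (t - s))) \<and>
     (\<forall>s. \<forall>x\<in>closure (D s). ((\<lambda>t. U t s x) \<longlongrightarrow> x) (at_right s)) \<and>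
     (\<forall>s x. \<forall>z\<in>resolvent_set (D s) (A s).
        ((\<lambda>t. resolvent (D s) (A s) z (U t s x)) \<longlongrightarrow> resolvent (D s) (A s) z x) (at_right s))"


section \<open>Hyperbolicity and the Green's function\<close>

definition compl_proj :: "(real \<Rightarrow> 'a::complex_banach \<Rightarrow>\<^sub>L 'a) \<Rightarrow> real \<Rightarrow> 'a \<Rightarrow>\<^sub>L 'a" where
  "compl_proj P t = id_blinfun - P t"

text \<open>
  \<open>unstable_part U P t s\<close> is \<open>U\<^sub>Q(t,s) : Q(s)X \<rightarrow> Q(t)X\<close> for arbitrary real \<open>t\<close>, \<open>s\<close>;
  it is meant to be applied to elements of \<open>Q(s)X\<close> only.
\<close>

definition unstable_part ::
  "(real \<Rightarrow> real \<Rightarrow> 'a::complex_banach \<Rightarrow>\<^sub>L 'a) \<Rightarrow> (real \<Rightarrow> 'a \<Rightarrow>\<^sub>L 'a) \<Rightarrow> real \<Rightarrow> real \<Rightarrow> 'a \<Rightarrow> 'a"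
where
  "unstable_part U P t s =
     (if s \<le> t then blinfun_apply (U t s) else inv_into (range (compl_proj P t)) (U s t))"

definition hyperbolic ::
  "(real \<Rightarrow> real \<Rightarrow> 'a::complex_banach \<Rightarrow>\<^sub>L 'a) \<Rightarrow> (real \<Rightarrow> 'a \<Rightarrow>\<^sub>L 'a) \<Rightarrow> real \<Rightarrow> real \<Rightarrow> bool"
where
  "hyperbolic U P M \<omega> \<longleftrightarrow>
     0 < M \<and> 0 < \<omega> \<and>
     (\<forall>t. clinear_op (P t) \<and> P t o\<^sub>L P t = P t) \<and>
     (\<exists>C. \<forall>t. norm (P t) \<le> C) \<and>
     (\<forall>x. continuous_on UNIV (\<lambda>t. P t x)) \<and>
     (\<forall>t s. s \<le> t \<longrightarrow>
        U t s o\<^sub>L P s = P t o\<^sub>L U t s \<and>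
        bij_betw (U t s) (range (compl_proj P s)) (range (compl_proj P t)) \<and>
        norm (U t s o\<^sub>L P s) \<le> M * exp (- \<omega> * (t - s)) \<and>
        onorm (\<lambda>x. unstable_part U P s t (compl_proj P t x)) \<le> M * exp (- \<omega> * (t - s)))"

definition green ::
  "(real \<Rightarrow> real \<Rightarrow> 'a::complex_banach \<Rightarrow>\<^sub>L 'a) \<Rightarrow> (real \<Rightarrow> 'a \<Rightarrow>\<^sub>L 'a) \<Rightarrow> real \<Rightarrow> real \<Rightarrow> 'a \<Rightarrow> 'a"
where
  "green U P t s x =
     (if s \<le> t then U t s (P s x) else - unstable_part U P t s (compl_proj P s x))"


section \<open>Mild solutions and quasi-asymptotic almost periodicity\<close>

definition mild_solution ::
  "(real \<Rightarrow> real \<Rightarrow> 'a::complex_banach \<Rightarrow>\<^sub>L 'a) \<Rightarrow> (real \<Rightarrow> 'a \<Rightarrow> 'a) \<Rightarrow> 'a \<Rightarrow> (real \<Rightarrow> 'a) \<Rightarrow> bool"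
where
  "mild_solution U F x u \<longleftrightarrow>
     continuous_on {0..} u \<and> bounded (u ` {0..}) \<and>
     (\<forall>t\<ge>0. (\<lambda>s. U t s (F s (u s))) integrable_on {0..t} \<and>
        u t = U t 0 x + integral {0..t} (\<lambda>s. U t s (F s (u s))))"

text \<open>
  The following classes consist of functions on \<open>[0,\<infinity>)\<close> and \<open>[0,\<infinity>) \<times> X\<close>; values at negative
  times play no role.
\<close>

definition QAAP :: "(real \<Rightarrow> 'a::complex_banach) set" where
  "QAAP = {f. continuous_on {0..} f \<and> bounded (f ` {0..}) \<and>
     (\<forall>\<epsilon>>0. \<exists>l>0. \<forall>a\<ge>0. \<exists>\<tau>\<in>{a..a + l}. \<exists>M>0.
        \<forall>t\<ge>0. \<bar>t\<bar> \<ge> M \<longrightarrow> norm (f (t + \<tau>) - f t) \<le> \<epsilon>)}"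

text \<open>
  In the two-parameter class no boundedness in \<open>t\<close> is required: \<open>F t x = ln (1 + t) *\<^sub>R v\<close>
  satisfies the condition. A statement about bounded mild solutions therefore has to assume
  separately that \<open>F\<close> is bounded on sets \<open>[0,\<infinity>) \<times> B\<close> with \<open>B\<close> bounded; for \<open>F\<close> which is
  Lipschitz in \<open>x\<close> uniformly in \<open>t\<close>, this amounts to boundedness of \<open>t \<mapsto> F t 0\<close>.
\<close>

definition QAAP2 :: "(real \<Rightarrow> 'a::complex_banach \<Rightarrow> 'a) set" where
  "QAAP2 = {F. continuous_on ({0..} \<times> UNIV) (\<lambda>(t, x). F t x) \<and>
     (\<forall>\<epsilon>>0. \<exists>l>0. \<forall>a\<ge>0. \<exists>\<tau>\<in>{a..a + l}. \<exists>M>0. \<forall>B. bounded B \<longrightarrow>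
        (\<forall>t\<ge>0. \<forall>x\<in>B. \<bar>t\<bar> \<ge> M \<longrightarrow> norm (F (t + \<tau>) x - F t x) \<le> \<epsilon>))}"

end

theory Submission
  imports Defs
begin

text \<open>
  Contraction gives a unique bounded mild solution \<open>u\<close>. If \<open>\<tau>\<close> is an \<open>\<epsilon>\<close>-quasi-period both of \<open>F\<close>
  and of the Green's function, then splitting the variation of constants formula at a late time shows
  \<open>limsup \<parallel>u(t + \<tau>) - u(t)\<parallel> \<le> C \<epsilon> + (M' L / \<omega>) limsup \<parallel>u(t + \<tau>) - u(t)\<parallel>\<close>, and \<open>M' L / \<omega> < 1\<close>.

  The difficulty is that the two hypotheses provide \<^emph>\<open>different\<close> relatively dense sets of quasi-periods,
  and two such sets can be disjoint in general. Differences of quasi-periods are again quasi-periods, so by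
  pigeonhole there are, in a relatively dense set, quasi-periods \<open>\<tau>\<close> of \<open>F\<close> and \<open>\<sigma>\<close> of the Green's
  function which are arbitrarily close to each other. It remains to see that every small number is a
  quasi-period of the Green's function, that is, that \<open>(t, s) \<mapsto> U(t, s)\<close> is continuous in the operator norm,
  uniformly on \<open>t - s \<ge> \<kappa>\<close>. In \<open>t\<close> this follows from the bound on \<open>A(t) U(t, s)\<close>; in \<open>s\<close> it is deduced
  from the Acquistapace--Terreni conditions: \<open>U(s, s - h) x - x\<close> is \<open>O(h\<^sup>\<mu>)\<close> in the weak norm
  \<open>\<parallel>(A(s) - \<omega>\<^sub>0)\<^sup>-\<^sup>1 x\<parallel>\<close>, and \<open>U(t, s)\<close> maps weakly small bounded sets to small ones.
\<close>

section \<open>A Tauberian lemma\<close>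

text \<open>Generation provides derivatives of \<open>U t s\<close> in t only; no bound on U(t,s)
  A(s) is at hand, so norm continuity in s has no direct proof. The task is to turn weak smallness
  of a bounded vector y into norm smallness of \<open>U (r + k) r y\<close>. Resolvents at real
  points act approximately as Laplace transforms of the orbit, but finitely many Laplace integrals
  do not control a value of a function unless that function varies slowly. The bound M / (t - s) on
  A(t) U(t,s) is invariant under rescaling of time and supplies the slow variation at every scale
  1/\<Lambda>. The condition \<mu> + \<nu> > 1 makes the cost of freezing the operator at the
  initial time tend to 0 as \<Lambda> grows.

  The limsup inequality is used as an iteration: an eventual bound for u(t + \<tau>) - u(t) is
  improved finitely often, starting from twice a bound of u. Each improvement has its own threshold
  in t.\<close>

text \<open>The primitive on the half-open interval is Lipschitz with constant B, hence extends
  continuously to b; the fundamental theorem in its interior form then recovers the integral. The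
  value \<open>f b\<close> is arbitrary, as is needed for kernels \<open>U t s\<close> that may jump
  at s = t.\<close>

lemma integrable_on_bounded_continuous_right:
  fixes f :: "real \<Rightarrow> 'a::banach"
  assumes cont: "continuous_on {a..<b} f" and bnd: "\<And>s. s \<in> {a..<b} \<Longrightarrow> norm (f s) \<le> B"
  shows "f integrable_on {a..b}"
proof (cases "a < b")
  case False
  then show ?thesis
    using integrable_on_refl[of f b] by (cases "a = b") auto
next
  case True
  define G where "G t = integral {a..t} f" for t
  have int: "f integrable_on {s..t}" if "a \<le> s" "t < b" for s t
    using that by (intro integrable_continuous_real continuous_on_subset[OF cont]) auto
  have lip': "norm (G t - G s) \<le> B * (t - s)" if "a \<le> s" "s \<le> t" "t < b" for s t
  proof -
    have "G t = G s + integral {s..t} f"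
      unfolding G_def using that
      by (subst Henstock_Kurzweil_Integration.integral_combine) (auto intro: int)
    moreover have "norm (integral {s..t} f) \<le> B * (t - s)"
      using that bnd by (intro integral_bound continuous_on_subset[OF cont]) auto
    ultimately show ?thesis by simp
  qed
  have "0 \<le> B" using bnd[of a] True by (auto intro: order_trans[OF norm_ge_zero])
  then have "B-lipschitz_on {a..<b} G"
    by (intro lipschitz_onI; simp add: dist_norm)
      (smt (verit) lip' norm_minus_commute real_norm_def)
  then have "uniformly_continuous_on {a..<b} G"
    by (rule lipschitz_on_uniformly_continuous)
  then obtain g where g: "uniformly_continuous_on (closure {a..<b}) g" "\<And>x. x \<in> {a..<b} \<Longrightarrow> G x = g x"
    by (rule uniformly_continuous_on_extension_on_closure) blast
  have "(f has_integral (g b - g a)) {a..b}"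
  proof (rule fundamental_theorem_of_calculus_interior)
    show "continuous_on {a..b} g"
      using uniformly_continuous_imp_continuous[OF g(1)] True by simp
  next
    fix x assume x: "x \<in> {a<..<b}"
    have "(G has_vector_derivative f x) (at x within {a..(x + b) / 2})"
      unfolding G_def using x
      by (intro integral_has_vector_derivative continuous_on_subset[OF cont]) auto
    then have "(G has_vector_derivative f x) (at x)"
      using x by (simp add: at_within_Icc_at)
    then show "(g has_vector_derivative f x) (at x)"
      by (rule has_vector_derivative_transform_within_open[of _ _ _ "{a<..<b}"]) (use x g(2) in auto)
  qed (use True in auto)
  then show ?thesis by blast
qed

lemma integrable_on_bounded_continuous_left:
  fixes f :: "real \<Rightarrow> 'a::banach"
  assumes "continuous_on {a<..b} f" and "\<And>s. s \<in> {a<..b} \<Longrightarrow> norm (f s) \<le> B"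
  shows "f integrable_on {a..b}"
proof -
  have "(\<lambda>x. f (- x)) integrable_on {-b..-a}"
  proof (rule integrable_on_bounded_continuous_right)
    show "continuous_on {-b..<-a} (\<lambda>x. f (- x))"
      by (rule continuous_on_compose2[OF assms(1)]) (auto intro: continuous_intros)
  next
    show "norm (f (- s)) \<le> B" if "s \<in> {-b..<-a}" for s
      using that by (intro assms(2)) auto
  qed
  then show ?thesis by simp
qed


text \<open>
  Wiener's Tauberian theorem in miniature: in the variable \<open>exp (- s)\<close> a bump around \<open>s = 1\<close> is
  approximated by a polynomial, so finitely many Laplace integrals control an average of \<open>v\<close> near \<open>1\<close>.
\<close>

lemma tauberian:
  fixes C \<epsilon> :: real
  assumes C: "0 < C" and \<epsilon>: "0 < \<epsilon>"
  shows "\<exists>N \<delta>. 0 < \<delta> \<and>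
    (\<forall>T (v :: real \<Rightarrow> 'a::banach).
       2 \<le> T \<longrightarrow> continuous_on {0<..T} v \<longrightarrow> (\<forall>s\<in>{0<..T}. norm (v s) \<le> C) \<longrightarrow>
       (\<forall>s\<in>{1/2..2}. norm (v s - v 1) \<le> C * \<bar>s - 1\<bar>) \<longrightarrow>
       (\<forall>j\<le>N. norm (integral {0..T} (\<lambda>s. exp (- (real (Suc j) * s)) *\<^sub>R v s)) \<le> \<delta>) \<longrightarrow>
       norm (v 1) \<le> \<epsilon>)"
proof -
  \<comment> \<open>Half-width of the bump \<open>h\<close>: on its support v differs from
    \<open>v 1\<close> by at most C \<rho> \<le> \<epsilon>/4, and \<rho> \<le> 1/2 keeps the
    support in the interval where slow variation is assumed.\<close>
  define \<rho> where "\<rho> = min (1/2) (\<epsilon> / (4 * C))"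
  have \<rho>: "0 < \<rho>" "\<rho> \<le> 1/2" "C * \<rho> \<le> \<epsilon> / 4"
    using C \<epsilon> by (auto simp: \<rho>_def min_def field_simps)
  define h where "h s = max 0 (1 - \<bar>s - 1\<bar> / \<rho>)" for s :: real
  \<comment> \<open>The approximation error e exp(-s) costs at most e C = \<epsilon> \<rho> / 8
    after integration against v, to be compared with the mass of \<open>h\<close>, which is at least
    \<rho>/2.\<close>
  define e where "e = \<epsilon> * \<rho> / (8 * C)"
  have e: "0 < e" using C \<epsilon> \<rho> by (simp add: e_def)
  \<comment> \<open>The bump in the variable x = exp(-s), divided by x. The division leaves a factor
    exp(-s) in front of the polynomial: its powers of exp(-s) start at 1, and the error stays
    integrable uniformly in \<open>T\<close>. Since \<open>h\<close> vanishes for large s, \<psi>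
    vanishes near 0 and is continuous there.\<close>
  define \<psi> where "\<psi> x = h (- ln x) / x" for x :: real
  have cont_h: "continuous_on S h" for S
    unfolding h_def by (intro continuous_intros) (use \<rho> in auto)
  have h_range: "0 \<le> h s" "h s \<le> 1" for s
    using \<rho> by (auto simp: h_def)
  have h_supp: "h s = 0" if "\<rho> \<le> \<bar>s - 1\<bar>" for s
    using that \<rho> by (simp add: h_def field_simps)
  have \<psi>0: "\<psi> x = 0" if "x \<in> {0..exp (-2)}" for x
  proof (cases "x > 0")
    case True
    then have "ln x \<le> -2" using that by (metis atLeastAtMost_iff exp_gt_zero ln_exp ln_le_cancel_iff)
    then show ?thesis using \<rho> by (simp add: \<psi>_def h_supp)
  next
    case False
    then show ?thesis using that by (simp add: \<psi>_def)
  qed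
  have "continuous_on ({0..exp (-2)} \<union> {exp (-2)..1}) \<psi>"
  proof (rule continuous_on_closed_Un)
    show "continuous_on {0..exp (-2)} \<psi>"
      by (rule continuous_on_eq[OF continuous_on_const[of _ 0]]) (simp add: \<psi>0)
    have "x \<noteq> 0" if "exp (-2) \<le> x" for x :: real
      using that by (metis exp_gt_zero not_le)
    then show "continuous_on {exp (-2)..1} \<psi>"
      unfolding \<psi>_def
      by (intro continuous_intros continuous_on_compose2[OF cont_h[of UNIV]]) auto
  qed auto
  moreover have "{0..exp (-2)} \<union> {exp (-2)..1} = {0..1::real}" by (subst ivl_disj_un) auto
  ultimately have "continuous_on {0..1} \<psi>" by simp
  then obtain p where p: "real_polynomial_function p" "\<And>x. x \<in> {0..1} \<Longrightarrow> \<bar>\<psi> x - p x\<bar> < e"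
    using Stone_Weierstrass_real_polynomial_function[of "{0..1::real}" \<psi> e] e by auto
  then obtain a n where an: "p = (\<lambda>x. \<Sum>i\<le>n. a i * x ^ i)"
    unfolding real_polynomial_function_iff_sum by blast
  define q where "q s = exp (- s) * p (exp (- s))" for s
  have q_sum: "q s = (\<Sum>i\<le>n. a i * exp (- (real (Suc i) * s)))" for s
    unfolding q_def an by (auto simp: sum_distrib_left exp_of_nat_mult[symmetric] exp_add[symmetric] algebra_simps intro!: sum.cong)
  have hq: "\<bar>h s - q s\<bar> \<le> e * exp (- s)" if "0 \<le> s" for s
  proof -
    have "\<bar>\<psi> (exp (- s)) - p (exp (- s))\<bar> \<le> e"
      using p(2)[of "exp (- s)"] that by simp
    then have "\<bar>\<psi> (exp (- s)) - p (exp (- s))\<bar> * exp (- s) \<le> e * exp (- s)"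
      by (intro mult_right_mono) auto
    also have "\<bar>\<psi> (exp (- s)) - p (exp (- s))\<bar> * exp (- s) = \<bar>(\<psi> (exp (- s)) - p (exp (- s))) * exp (- s)\<bar>"
      by (simp add: abs_mult)
    finally show ?thesis
      by (simp add: \<psi>_def q_def algebra_simps)
  qed
  define \<delta> where "\<delta> = \<epsilon> * \<rho> / (8 * (1 + (\<Sum>i\<le>n. \<bar>a i\<bar>)))"
  have a0: "0 < 1 + (\<Sum>i\<le>n. \<bar>a i\<bar>)" by (rule add_pos_nonneg) (simp_all add: sum_nonneg)
  have \<delta>: "0 < \<delta>" unfolding \<delta>_def by (intro divide_pos_pos mult_pos_pos \<epsilon> \<rho> a0) simp
  show ?thesis
  proof (intro exI[of _ n] exI[of _ \<delta>] conjI allI impI \<delta>)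
    fix T and v :: "real \<Rightarrow> 'a"
    assume T: "2 \<le> T" and contv: "continuous_on {0<..T} v"
      and "\<forall>s\<in>{0<..T}. norm (v s) \<le> C"
      and "\<forall>s\<in>{1/2..2}. norm (v s - v 1) \<le> C * \<bar>s - 1\<bar>"
      and "\<forall>j\<le>n. norm (integral {0..T} (\<lambda>s. exp (- (real (Suc j) * s)) *\<^sub>R v s)) \<le> \<delta>"
    then have bnd: "\<And>s. s \<in> {0<..T} \<Longrightarrow> norm (v s) \<le> C"
      and slow: "\<And>s. s \<in> {1/2..2} \<Longrightarrow> norm (v s - v 1) \<le> C * \<bar>s - 1\<bar>"
      and small: "\<And>j. j \<le> n \<Longrightarrow> norm (integral {0..T} (\<lambda>s. exp (- (real (Suc j) * s)) *\<^sub>R v s)) \<le> \<delta>"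
      by blast+
    have int: "(\<lambda>s. f s *\<^sub>R w s) integrable_on {0..T}"
      if f: "continuous_on {0..T} f" and w: "continuous_on {0<..T} w" "\<And>s. s \<in> {0<..T} \<Longrightarrow> norm (w s) \<le> B"
      for f :: "real \<Rightarrow> real" and w :: "real \<Rightarrow> 'a" and B
    proof -
      have "bounded (f ` {0..T})"
        using f by (intro compact_imp_bounded compact_continuous_image) auto
      then obtain b where b: "\<forall>s\<in>{0..T}. \<bar>f s\<bar> \<le> b" "0 < b"
        by (metis bounded_pos imageI real_norm_def)
      show ?thesis
      proof (rule integrable_on_bounded_continuous_left)
        show "continuous_on {0<..T} (\<lambda>s. f s *\<^sub>R w s)"
          by (intro continuous_intros w continuous_on_subset[OF f]) auto
        show "norm (f s *\<^sub>R w s) \<le> b * B" if "s \<in> {0<..T}" for s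
          using b(1) w(2)[of s] that b(2) by (auto intro!: mult_mono)
      qed
    qed
    define I where "I = integral {0..T} h"
    have int_h: "h integrable_on {0..T}" by (intro integrable_continuous_real cont_h)
    have "integral {1-\<rho>/2..1+\<rho>/2} (\<lambda>_. 1/2::real) \<le> integral {0..T} h"
    proof (rule order_trans[OF Henstock_Kurzweil_Integration.integral_le])
      show "integral {1-\<rho>/2..1+\<rho>/2} h \<le> integral {0..T} h"
        by (rule integral_subset_le) (use \<rho> T h_range in \<open>auto intro!: integrable_continuous_real cont_h\<close>)
      show "1/2 \<le> h s" if "s \<in> {1-\<rho>/2..1+\<rho>/2}" for s
      proof -
        have "\<bar>s - 1\<bar> / \<rho> \<le> 1/2" using that \<rho> by (simp add: field_simps abs_if)
        then show ?thesis unfolding h_def by (intro max.coboundedI2) linarith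
      qed
    qed (use \<rho> in \<open>auto intro!: integrable_continuous_real cont_h\<close>)
    then have I: "\<rho> / 2 \<le> I" using \<rho> by (simp add: I_def)
    have Iv: "I *\<^sub>R v 1 = integral {0..T} (\<lambda>s. h s *\<^sub>R v 1)"
      unfolding I_def using integral_linear[OF int_h bounded_linear_scaleR_left[of "v 1"]]
      by (simp add: o_def)
    have contq: "continuous_on S q" for S
      unfolding q_sum by (intro continuous_intros)
    have qv: "norm (integral {0..T} (\<lambda>s. q s *\<^sub>R v s)) \<le> \<epsilon> * \<rho> / 8"
    proof -
      have "integral {0..T} (\<lambda>s. q s *\<^sub>R v s)
          = integral {0..T} (\<lambda>s. \<Sum>i\<le>n. a i *\<^sub>R exp (- (real (Suc i) * s)) *\<^sub>R v s)"
        by (simp add: q_sum scaleR_sum_left)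
      also have "\<dots> = (\<Sum>i\<le>n. integral {0..T} (\<lambda>s. a i *\<^sub>R exp (- (real (Suc i) * s)) *\<^sub>R v s))"
        by (rule integral_sum) (auto intro!: integrable_cmul int[OF _ contv bnd] continuous_intros simp del: scaleR_scaleR)
      also have "\<dots> = (\<Sum>i\<le>n. a i *\<^sub>R integral {0..T} (\<lambda>s. exp (- (real (Suc i) * s)) *\<^sub>R v s))"
        by (intro sum.cong refl integral_cmul)
      also have "norm \<dots> \<le> (\<Sum>i\<le>n. \<bar>a i\<bar> * \<delta>)"
        using small by (intro sum_norm_le) (auto intro!: mult_left_mono)
      also have "\<dots> = (\<Sum>i\<le>n. \<bar>a i\<bar>) * \<delta>" by (simp add: sum_distrib_right)
      also have "\<dots> \<le> (1 + (\<Sum>i\<le>n. \<bar>a i\<bar>)) * \<delta>" using \<delta> by (intro mult_right_mono) auto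
      also have "\<dots> = \<epsilon> * \<rho> / 8" using a0 by (simp add: \<delta>_def field_simps)
      finally show ?thesis .
    qed
    have hqv: "norm (integral {0..T} (\<lambda>s. (h s - q s) *\<^sub>R v s)) \<le> \<epsilon> * \<rho> / 8"
    proof -
      have exp_int: "((\<lambda>s. e * C * exp (- s)) has_integral (- (e * C * exp (- T)) - (- (e * C * exp (- 0))))) {0..T}"
        using T by (intro fundamental_theorem_of_calculus)
          (auto intro!: derivative_eq_intros simp: has_real_derivative_iff_has_vector_derivative[symmetric])
      \<comment> \<open>Nothing is known about \<open>v 0\<close>; replacing it by 0 makes the
        pointwise bound hold on the closed interval and leaves the integral unchanged.\<close>
      have "norm (integral {0..T} (\<lambda>s. (h s - q s) *\<^sub>R (if s = 0 then 0 else v s))) \<le> integral {0..T} (\<lambda>s. e * C * exp (- s))"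
      proof (rule Henstock_Kurzweil_Integration.integral_norm_bound_integral)
        show "(\<lambda>s. (h s - q s) *\<^sub>R (if s = 0 then 0 else v s)) integrable_on {0..T}"
        proof (rule int)
          show "continuous_on {0<..T} (\<lambda>s. if s = 0 then 0 else v s)"
            using contv by (rule continuous_on_eq) auto
        qed (use bnd in \<open>auto intro!: continuous_intros cont_h contq\<close>)
        show "norm ((h s - q s) *\<^sub>R (if s = 0 then 0 else v s)) \<le> e * C * exp (- s)"
          if "s \<in> {0..T}" for s
        proof (cases "s = 0")
          case False
          then have "\<bar>h s - q s\<bar> * norm (v s) \<le> (e * exp (- s)) * C"
            using that hq[of s] bnd[of s] e by (intro mult_mono) auto
          with False show ?thesis by (simp add: mult_ac)
        qed (use e C in auto)
      qed (use exp_int in blast)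
      also have "\<dots> \<le> e * C" by (subst integral_unique[OF exp_int]) (use e C in simp)
      also have "\<dots> = \<epsilon> * \<rho> / 8" using C by (simp add: e_def)
      also have "integral {0..T} (\<lambda>s. (h s - q s) *\<^sub>R (if s = 0 then 0 else v s)) =
          integral {0..T} (\<lambda>s. (h s - q s) *\<^sub>R v s)"
        by (rule integral_spike[of "{0}"]) auto
      finally show ?thesis .
    qed
    have hv: "norm (integral {0..T} (\<lambda>s. h s *\<^sub>R (v 1 - v s))) \<le> \<epsilon> / 4 * I"
      unfolding I_def
    proof (subst integral_mult_right[symmetric], rule Henstock_Kurzweil_Integration.integral_norm_bound_integral)
      show "(\<lambda>s. h s *\<^sub>R (v 1 - v s)) integrable_on {0..T}"
      proof (rule int)
        show "norm (v 1 - v s) \<le> C + C" if "s \<in> {0<..T}" for s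
          using norm_triangle_ineq4[of "v 1" "v s"] bnd[of 1] bnd[of s] that T by auto
      qed (auto intro!: cont_h continuous_intros contv)
      show "norm (h s *\<^sub>R (v 1 - v s)) \<le> \<epsilon> / 4 * h s" for s
      proof (cases "\<rho> \<le> \<bar>s - 1\<bar>")
        case False
        then have "norm (v s - v 1) \<le> C * \<bar>s - 1\<bar>" using \<rho> by (intro slow) auto
        also have "\<dots> \<le> C * \<rho>" using False C by (intro mult_left_mono) auto
        also have "\<dots> \<le> \<epsilon> / 4" by fact
        finally have "h s * norm (v s - v 1) \<le> h s * (\<epsilon> / 4)"
          using h_range by (intro mult_left_mono) auto
        then show ?thesis using h_range(1)[of s] by (simp add: norm_minus_commute mult.commute)
      qed (simp add: h_supp)
    qed (auto intro!: integrable_continuous_real cont_h continuous_intros)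
    have "I *\<^sub>R v 1 = integral {0..T} (\<lambda>s. h s *\<^sub>R (v 1 - v s) + ((h s - q s) *\<^sub>R v s + q s *\<^sub>R v s))"
      unfolding Iv by (intro integral_cong) (simp add: algebra_simps)
    also have "\<dots> = integral {0..T} (\<lambda>s. h s *\<^sub>R (v 1 - v s)) +
        (integral {0..T} (\<lambda>s. (h s - q s) *\<^sub>R v s) + integral {0..T} (\<lambda>s. q s *\<^sub>R v s))"
    proof -
      have 1: "(\<lambda>s. h s *\<^sub>R (v 1 - v s)) integrable_on {0..T}"
      proof (rule int)
        show "norm (v 1 - v s) \<le> C + C" if "s \<in> {0<..T}" for s
          using norm_triangle_ineq4[of "v 1" "v s"] bnd[of 1] bnd[of s] that T by auto
      qed (auto intro!: cont_h continuous_intros contv)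
      have 2: "(\<lambda>s. (h s - q s) *\<^sub>R v s) integrable_on {0..T}" "(\<lambda>s. q s *\<^sub>R v s) integrable_on {0..T}"
        by (intro int[OF _ contv bnd] continuous_intros cont_h contq; assumption)+
      show ?thesis
        by (simp only: Henstock_Kurzweil_Integration.integral_add 1 2 integrable_add)
    qed
    also have "norm \<dots> \<le> \<epsilon> / 4 * I + (\<epsilon> * \<rho> / 8 + \<epsilon> * \<rho> / 8)"
      by (intro order_trans[OF norm_triangle_ineq] add_mono hv hqv qv)
    \<comment> \<open>Because \<rho>/2 \<le> I, the three errors add up to at most 3/4 of \<epsilon>
      I.\<close>
    also have "\<dots> \<le> \<epsilon> * I"
    proof -
      have "\<epsilon> * (\<rho> / 2) \<le> \<epsilon> * I" using I \<epsilon> by (intro mult_left_mono) auto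
      moreover have "\<epsilon> / 4 * I = \<epsilon> * I / 4" by simp
      ultimately show ?thesis using mult_pos_pos[OF \<epsilon> \<rho>(1)] by linarith
    qed
    finally have "I * norm (v 1) \<le> I * \<epsilon>" using I \<rho> by (simp add: mult.commute)
    then show "norm (v 1) \<le> \<epsilon>" using I \<rho> by simp
  qed
qed

section \<open>Norm continuity of parabolic evolution systems\<close>

text \<open>
  Here \<open>B t\<close> stands for \<open>A(t) - w\<close> and \<open>R l t\<close> for \<open>(l - B t)\<^sup>-\<^sup>1\<close>; only real \<open>l\<close> are needed.
  In particular \<open>R 0 t = - (B t)\<^sup>-\<^sup>1\<close>, and \<open>norm (R 0 t x)\<close> is the weak norm in which the evolution
  system attains all initial values.
\<close>

locale parabolic_evolution =
  fixes D :: "real \<Rightarrow> 'a::banach set" and B :: "real \<Rightarrow> 'a \<Rightarrow> 'a"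
    and U AU :: "real \<Rightarrow> real \<Rightarrow> 'a \<Rightarrow>\<^sub>L 'a" and R :: "real \<Rightarrow> real \<Rightarrow> 'a \<Rightarrow> 'a"
    and w \<mu> \<nu> K M :: real
  assumes params: "0 < \<mu>" "\<mu> \<le> 1" "0 < \<nu>" "\<nu> \<le> 1" "1 < \<mu> + \<nu>" "0 \<le> w" "1 \<le> K" "1 \<le> M"
    and R_linear: "0 \<le> l \<Longrightarrow> bounded_linear (R l t)"
    and R_norm: "0 \<le> l \<Longrightarrow> norm (R l t x) \<le> K / (1 + l) * norm x"
    and R_mem: "0 \<le> l \<Longrightarrow> R l t x \<in> D t"
    and R_right: "0 \<le> l \<Longrightarrow> l *\<^sub>R R l t x - B t (R l t x) = x"
    and R_left: "0 \<le> l \<Longrightarrow> x \<in> D t \<Longrightarrow> R l t (l *\<^sub>R x - B t x) = x"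
    and AT: "0 < l \<Longrightarrow>
      norm (B t (R l t (R 0 t x - R 0 s x))) \<le> K * \<bar>t - s\<bar> powr \<mu> * l powr (- \<nu>) * norm x"
    and U_mem: "s < t \<Longrightarrow> U t s x \<in> D t"
    and U_deriv: "s < t \<Longrightarrow> ((\<lambda>r. U r s) has_vector_derivative AU t s) (at t)"
    and AU_eq: "s < t \<Longrightarrow> AU t s x = B t (U t s x) + w *\<^sub>R U t s x"
    and U_norm: "s \<le> t \<Longrightarrow> norm (U t s) \<le> M"
    and AU_norm: "s < t \<Longrightarrow> t \<le> s + 1 \<Longrightarrow> norm (AU t s) \<le> M / (t - s)"
    and weak_initial: "0 \<le> l \<Longrightarrow> ((\<lambda>t. R l s (U t s x)) \<longlongrightarrow> R l s x) (at_right s)"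
    and U_refl: "U s s = id_blinfun"
    and U_trans: "s \<le> r \<Longrightarrow> r \<le> t \<Longrightarrow> U t s = U t r o\<^sub>L U r s"
begin

section \<open>Resolvent estimates and their dependence on time\<close>

lemma B_R: "0 \<le> l \<Longrightarrow> B t (R l t x) = l *\<^sub>R R l t x - x"
  using R_right[of l t x] by (simp add: algebra_simps)

lemma R_diff: "0 \<le> l \<Longrightarrow> R l t (x - y) = R l t x - R l t y"
  using R_linear by (rule linear_diff[OF bounded_linear.linear])

lemma R_minus: "0 \<le> l \<Longrightarrow> R l t (- x) = - R l t x"
  using R_linear by (rule linear_neg[OF bounded_linear.linear])

lemma R_add: "0 \<le> l \<Longrightarrow> R l t (x + y) = R l t x + R l t y"
  using R_linear by (rule linear_add[OF bounded_linear.linear])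

lemma R_scale: "0 \<le> l \<Longrightarrow> R l t (c *\<^sub>R x) = c *\<^sub>R R l t x"
  using R_linear by (rule linear_cmul[OF bounded_linear.linear])

lemma R_norm': "0 \<le> l \<Longrightarrow> norm (R l t x) \<le> K * norm x"
proof (rule order_trans[OF R_norm])
  assume "0 \<le> l"
  then have "K / (1 + l) \<le> K" using params by (simp add: field_simps)
  then show "K / (1 + l) * norm x \<le> K * norm x" by (rule mult_right_mono) simp
qed

lemma R0_B: "x \<in> D t \<Longrightarrow> R 0 t (B t x) = - x"
  using arg_cong[OF R_left[of 0 x t], of uminus] by (simp add: R_minus)

lemma R_via_R0: "0 \<le> l \<Longrightarrow> R l t x = R 0 t x - l *\<^sub>R R l t (R 0 t x)"
  using R_left[OF _ R_mem[of 0 t x], of l] B_R[of 0 t x] by (simp add: R_diff R_scale R_add algebra_simps)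

text \<open>In the resolvent identity the factor l is absorbed by the decay K / (1 + l). Thus the
  weak norm controls all resolvents with a constant independent of l.\<close>

lemma R_norm_R0:
  assumes "0 \<le> l"
  shows "norm (R l t x) \<le> (K + 1) * norm (R 0 t x)"
proof -
  have "l * norm (R l t (R 0 t x)) \<le> l * (K / (1 + l) * norm (R 0 t x))"
    using R_norm assms by (intro mult_left_mono) auto
  also have "\<dots> = (l / (1 + l)) * (K * norm (R 0 t x))" by simp
  also have "\<dots> \<le> 1 * (K * norm (R 0 t x))"
    using assms params by (intro mult_right_mono) (auto simp: field_simps)
  finally have "l * norm (R l t (R 0 t x)) \<le> K * norm (R 0 t x)" by simp
  moreover have "norm (R l t x) \<le> norm (R 0 t x) + norm (l *\<^sub>R R l t (R 0 t x))"
    by (subst R_via_R0[OF assms, of t x]) (rule norm_triangle_ineq4)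
  ultimately show ?thesis using assms by (simp add: distrib_right)
qed

text \<open>For s = t the difference on the left is zero. In general, with b = \<open>B s v\<close>,
  one has \<open>R 0 s b = - v\<close>, and the defect becomes
  \<open>- B t (R l t (R 0 t b - R 0 s b))\<close>, the quantity bounded by the second
  Acquistapace--Terreni condition.\<close>

lemma R_B:
  assumes l: "0 < l" and v: "v \<in> D s"
  shows "norm (R l t (B s v) - (l *\<^sub>R R l t v - v)) \<le> K * \<bar>t - s\<bar> powr \<mu> * l powr (- \<nu>) * norm (B s v)"
proof -
  let ?b = "B s v"
  have 1: "R l t ?b = R 0 t ?b - l *\<^sub>R R l t (R 0 t ?b)"
    using l by (intro R_via_R0) auto
  have 2: "R 0 t ?b - R 0 s ?b = R 0 t ?b + v" by (simp add: R0_B[OF v])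
  have "B t (R l t (R 0 t ?b + v)) = l *\<^sub>R (R l t (R 0 t ?b) + R l t v) - (R 0 t ?b + v)"
    using B_R[of l t "R 0 t ?b + v"] l by (simp add: R_add)
  then have "R l t ?b - (l *\<^sub>R R l t v - v) = - B t (R l t (R 0 t ?b - R 0 s ?b))"
    unfolding 1 2 by (simp add: algebra_simps)
  then show ?thesis using AT[OF l] by (metis norm_minus_cancel)
qed

text \<open>At l = 1 the second condition bounds e = \<open>B t (R 1 t d)\<close>, and d is
  recovered from e as - \<open>R 0 t e\<close> - e.\<close>

lemma R0_diff: "norm (R 0 t x - R 0 s x) \<le> K * (K + 1) * \<bar>t - s\<bar> powr \<mu> * norm x"
proof -
  define d where "d = R 0 t x - R 0 s x"
  define e where "e = B t (R 1 t d)"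
  have e: "norm e \<le> K * \<bar>t - s\<bar> powr \<mu> * norm x"
    using AT[of 1 t x s] by (simp add: e_def d_def)
  have "R 0 t e = - R 1 t d" unfolding e_def by (intro R0_B R_mem) simp
  moreover have "e = R 1 t d - d" unfolding e_def using B_R[of 1 t d] by simp
  ultimately have "d = - R 0 t e - e" by simp
  then have "norm d \<le> norm (R 0 t e) + norm e"
    by (metis norm_minus_cancel norm_triangle_ineq4)
  also have "\<dots> \<le> (K + 1) * norm e" using R_norm'[of 0 t e] by (simp add: algebra_simps)
  also have "\<dots> \<le> (K + 1) * (K * \<bar>t - s\<bar> powr \<mu> * norm x)"
    using e params by (intro mult_left_mono) auto
  finally show ?thesis by (simp add: d_def mult_ac)
qed

section \<open>Orbits in the norm and in the weak norm\<close>

lemma U_apply: "s \<le> t \<Longrightarrow> norm (U t s x) \<le> M * norm x"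
  by (rule order_trans[OF norm_blinfun mult_right_mono[OF U_norm]]) auto

lemma AU_apply: "s < t \<Longrightarrow> t \<le> s + 1 \<Longrightarrow> norm (AU t s x) \<le> M / (t - s) * norm x"
  by (rule order_trans[OF norm_blinfun mult_right_mono[OF AU_norm]]) auto

lemma BU_apply:
  assumes "s < t" "t \<le> s + 1"
  shows "norm (B t (U t s x)) \<le> M * (1 + w) / (t - s) * norm x"
proof -
  have "norm (B t (U t s x)) \<le> norm (AU t s x) + norm (w *\<^sub>R U t s x)"
    using AU_eq[OF assms(1), of x] norm_triangle_ineq4[of "AU t s x" "w *\<^sub>R U t s x"] by simp
  also have "\<dots> \<le> M / (t - s) * norm x + w * (M * norm x)"
    using AU_apply[OF assms] U_apply[of s t x] assms params
    by (intro add_mono) (auto intro!: mult_left_mono)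
  also have "w * (M * norm x) \<le> w * (M / (t - s) * norm x)"
    using assms params mult_left_le[of "t - s" M]
    by (intro mult_left_mono mult_right_mono) (auto simp: pos_le_divide_eq)
  finally show ?thesis by (simp add: algebra_simps add_divide_distrib)
qed

lemma U_deriv_apply: "s < t \<Longrightarrow> ((\<lambda>r. U r s x) has_vector_derivative AU t s x) (at t)"
  using bounded_linear.has_vector_derivative[OF blinfun.bounded_linear_left U_deriv] by simp

lemma R_U_deriv:
  assumes "0 \<le> l" "s < t"
  shows "((\<lambda>r. R l s (U r s x)) has_vector_derivative R l s (AU t s x)) (at t)"
  by (rule bounded_linear.has_vector_derivative[OF R_linear[OF assms(1)] U_deriv_apply[OF assms(2)]])

text \<open>The orbit itself may fail to tend to x at the left endpoint; continuity there is the
  weak initial condition.\<close>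

lemma R_U_cont:
  assumes "0 \<le> l"
  shows "continuous_on {s..t} (\<lambda>r. R l s (U r s x))"
  unfolding continuous_on_eq_continuous_within
proof
  fix r assume r: "r \<in> {s..t}"
  show "continuous (at r within {s..t}) (\<lambda>r. R l s (U r s x))"
  proof (cases "r = s")
    case True
    have "((\<lambda>t. R l s (U t s x)) \<longlongrightarrow> R l s x) (at s within {s..t})"
      by (rule tendsto_within_subset[of _ _ _ "{s..}"])
        (use weak_initial[OF assms] in \<open>auto simp: at_within_Ici_at_right\<close>)
    then show ?thesis by (simp add: True continuous_within U_refl)
  next
    case False
    then have "s < r" using r by simp
    from has_vector_derivative_continuous[OF R_U_deriv[OF assms this]]
    show ?thesis by (rule continuous_at_imp_continuous_at_within)
  qed
qed

text \<open>The first summand arises from integrating the derivative of the weak orbit, whence the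
  division by \<mu>; the second pays for moving the weak norm from time s to time s + h.\<close>

definition weak_modulus where "weak_modulus = (K * (K + 1) * (M * (1 + w)) + (1 + w * K) * M) / \<mu> + K * (K + 1) * (M + 1)"

text \<open>Differentiating \<open>R 0 s (U r s x)\<close> produces \<open>R 0 s\<close> applied to
  \<open>B r (U r s x)\<close>. With \<open>R 0 r\<close> instead, B would cancel and leave a
  bounded term. The exchange costs (r - s) powr \<mu> times the singularity 1 / (r - s), which is
  integrable since \<mu> > 0.\<close>

lemma weak_continuity:
  assumes h: "0 < h" "h \<le> 1"
  shows "norm (R 0 (s + h) (U (s + h) s x - x)) \<le> weak_modulus * h powr \<mu> * norm x"
proof -
  define c where "c = K * (K + 1) * (M * (1 + w)) + (1 + w * K) * M"
  have "norm (R 0 s (U (s + h) s x) - R 0 s (U s s x)) \<le>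
      c / \<mu> * norm x * (s + h - s) powr \<mu> - c / \<mu> * norm x * (s - s) powr \<mu>"
  proof (rule differentiable_bound_general)
    show "continuous_on {s..s + h} (\<lambda>r. c / \<mu> * norm x * (r - s) powr \<mu>)"
      by (intro continuous_on_mult continuous_on_const continuous_on_powr' continuous_on_diff continuous_on_id)
        (use params in auto)
  next
    fix r assume r: "s < r" "r < s + h"
    show "((\<lambda>r. R 0 s (U r s x)) has_vector_derivative R 0 s (AU r s x)) (at r)"
      using r by (intro R_U_deriv) auto
    show "((\<lambda>r. c / \<mu> * norm x * (r - s) powr \<mu>) has_vector_derivative c * norm x * (r - s) powr (\<mu> - 1)) (at r)"
      unfolding has_real_derivative_iff_has_vector_derivative[symmetric]
      using r params by (auto intro!: derivative_eq_intros simp: field_simps powr_diff)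
    let ?v = "U r s x"
    let ?b = "B r ?v"
    have D: "?v \<in> D r" using r by (intro U_mem)
    have b: "norm ?b \<le> M * (1 + w) / (r - s) * norm x" using r h by (intro BU_apply) auto
    have v: "norm ?v \<le> M * norm x" using r by (intro U_apply) auto
    have "R 0 s (AU r s x) = (R 0 s ?b - R 0 r ?b) + (w *\<^sub>R R 0 s ?v - ?v)"
      using r by (simp add: AU_eq R_add R_scale R0_B[OF D])
    also have "norm \<dots> \<le> norm (R 0 s ?b - R 0 r ?b) + (w * norm (R 0 s ?v) + norm ?v)"
      using norm_triangle_ineq4[of "w *\<^sub>R R 0 s ?v" ?v] params
      by (intro order_trans[OF norm_triangle_ineq]) auto
    also have "\<dots> \<le> K * (K + 1) * \<bar>s - r\<bar> powr \<mu> * norm ?b + (w * (K * norm ?v) + norm ?v)"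
      using R0_diff[of s ?b r] R_norm'[of 0 s ?v] params
      by (intro add_mono mult_left_mono) auto
    also have "\<dots> \<le> K * (K + 1) * (r - s) powr \<mu> * (M * (1 + w) / (r - s) * norm x) + (w * (K * (M * norm x)) + M * norm x)"
      using b v params r by (intro add_mono mult_left_mono mult_mono) auto
    also have "\<dots> = K * (K + 1) * (M * (1 + w)) * norm x * (r - s) powr (\<mu> - 1) + (1 + w * K) * M * norm x * 1"
      using r by (simp add: powr_diff field_simps)
    \<comment> \<open>As r - s < 1 and \<mu> \<le> 1, the bounded terms are absorbed into the
      singular one.\<close>
    also have "\<dots> \<le> K * (K + 1) * (M * (1 + w)) * norm x * (r - s) powr (\<mu> - 1) + (1 + w * K) * M * norm x * (r - s) powr (\<mu> - 1)"
    proof -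
      have "(r - s) powr 0 \<le> (r - s) powr (\<mu> - 1)"
        using r h params by (intro powr_mono') auto
      then show ?thesis using r params by (intro add_left_mono mult_left_mono) auto
    qed
    also have "\<dots> = c * norm x * (r - s) powr (\<mu> - 1)" by (simp add: c_def algebra_simps)
    finally show "norm (R 0 s (AU r s x)) \<le> c * norm x * (r - s) powr (\<mu> - 1)" .
  qed (use h R_U_cont in auto)
  then have 1: "norm (R 0 s (U (s + h) s x - x)) \<le> c / \<mu> * h powr \<mu> * norm x"
    using params by (simp add: U_refl R_diff mult_ac)
  \<comment> \<open>The weak norm is now transferred to s + h, the time from which the evolution
    will be restarted.\<close>
  let ?y = "U (s + h) s x - x"
  have "norm ?y \<le> (M + 1) * norm x"
    using norm_triangle_ineq4[of "U (s + h) s x" x] U_apply[of s "s + h" x] h by (simp add: algebra_simps)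
  then have "K * (K + 1) * h powr \<mu> * norm ?y \<le> K * (K + 1) * h powr \<mu> * ((M + 1) * norm x)"
    using params h by (intro mult_left_mono) auto
  then have 2: "norm (R 0 (s + h) ?y - R 0 s ?y) \<le> K * (K + 1) * h powr \<mu> * ((M + 1) * norm x)"
    using R0_diff[of "s + h" ?y s] h by simp
  have "norm (R 0 (s + h) ?y) \<le> norm (R 0 s ?y) + norm (R 0 (s + h) ?y - R 0 s ?y)"
    by (metis add.commute diff_add_cancel norm_triangle_ineq)
  also have "\<dots> \<le> c / \<mu> * h powr \<mu> * norm x + K * (K + 1) * h powr \<mu> * ((M + 1) * norm x)"
    using 1 2 by simp
  also have "\<dots> = weak_modulus * h powr \<mu> * norm x" by (simp add: weak_modulus_def c_def algebra_simps)
  finally show ?thesis .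
qed


text \<open>
  Weakly small initial values become small in norm after an arbitrarily short time. With
  \<open>v(s) = U(r + s/\<Lambda>, r) y\<close> the derivative of \<open>\<Lambda> e\<^sup>-\<^sup>j\<^sup>s R(j\<Lambda>) v(s)\<close> is \<open>- e\<^sup>-\<^sup>j\<^sup>s v(s)\<close> up to
  an error of order \<open>\<Lambda> powr (1 - \<mu> - \<nu>)\<close>, by the second Acquistapace--Terreni condition. Hence the
  Laplace integrals of \<open>v\<close> at \<open>1, 2, \<dots>\<close> are small, and the Tauberian lemma applies.
\<close>

lemma weak_small:
  assumes pos: "0 < \<epsilon>" "0 < \<kappa>" "0 < b"
  shows "\<exists>k \<eta>. 0 < k \<and> k \<le> \<kappa> \<and> 0 < \<eta> \<and>
    (\<forall>r y. norm y \<le> b \<longrightarrow> norm (R 0 r y) \<le> \<eta> \<longrightarrow> norm (U (r + k) r y) \<le> \<epsilon>)"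
proof -
  \<comment> \<open>One constant for both bounds in the Tauberian lemma: the rescaled orbit is
    bounded by M b and has Lipschitz constant 2 M b on [1/2, 2].\<close>
  have "0 < 2 * M * b" using params pos by simp
  from tauberian[where 'a = 'a, OF this pos(1)] obtain N \<delta> where \<delta>: "0 < \<delta>" and
    taub: "\<forall>T (v :: real \<Rightarrow> 'a).
       2 \<le> T \<longrightarrow> continuous_on {0<..T} v \<longrightarrow> (\<forall>s\<in>{0<..T}. norm (v s) \<le> 2 * M * b) \<longrightarrow>
       (\<forall>s\<in>{1/2..2}. norm (v s - v 1) \<le> 2 * M * b * \<bar>s - 1\<bar>) \<longrightarrow>
       (\<forall>j\<le>N. norm (integral {0..T} (\<lambda>s. exp (- (real (Suc j) * s)) *\<^sub>R v s)) \<le> \<delta>) \<longrightarrow>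
       norm (v 1) \<le> \<epsilon>"
    by (elim exE conjE)
  define \<theta> where "\<theta> = \<mu> + \<nu> - 1"
  have \<theta>: "0 < \<theta>" "\<theta> \<le> 1" using params by (auto simp: \<theta>_def)
  \<comment> \<open>\<open>c\<close> bounds the integrand up to the factor \<Lambda> powr (-
    \<theta>); in \<open>c1\<close> the factor 1 + Gamma \<mu> bounds the integral of exp(-s) (1 + s
    powr (\<mu> - 1)).\<close>
  define c where "c = K * M * b * (1 + w)"
  define c1 where "c1 = c * (1 + Gamma \<mu>)"
  have c: "0 < c" using params pos by (simp add: c_def)
  have "((\<lambda>\<Lambda>. c1 * \<Lambda> powr (- \<theta>)) \<longlongrightarrow> 0) at_top"
    by (intro tendsto_mult_right_zero tendsto_neg_powr filterlim_ident) (use \<theta> in simp)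
  moreover have "((\<lambda>\<Lambda>. K * M * b * exp (- \<Lambda>)) \<longlongrightarrow> 0) at_top"
    by (intro tendsto_mult_right_zero filterlim_compose[OF exp_at_bot filterlim_uminus_at_bot_at_top])
  ultimately have "eventually (\<lambda>\<Lambda>. c1 * \<Lambda> powr (- \<theta>) < \<delta> / 3) at_top"
    "eventually (\<lambda>\<Lambda>. K * M * b * exp (- \<Lambda>) < \<delta> / 3) at_top"
    using \<delta> by (simp_all only: order_tendstoD(2) divide_pos_pos zero_less_numeral)
  \<comment> \<open>\<delta> is split in three: the freezing error, the boundary term at s =
    \<Lambda>, and the boundary term at s = 0. The last is made small by \<eta>, chosen after
    \<Lambda>. The final conditions give room for the Tauberian interval and make the delay
    1/\<Lambda> at most \<kappa>.\<close>
  then have "eventually (\<lambda>\<Lambda>. c1 * \<Lambda> powr (- \<theta>) < \<delta> / 3 \<and> K * M * b * exp (- \<Lambda>) < \<delta> / 3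
      \<and> 2 \<le> \<Lambda> \<and> 1 / \<kappa> \<le> \<Lambda>) at_top"
    by (intro eventually_conj eventually_ge_at_top)
  then obtain \<Lambda> where \<Lambda>: "c1 * \<Lambda> powr (- \<theta>) < \<delta> / 3" "K * M * b * exp (- \<Lambda>) < \<delta> / 3" "2 \<le> \<Lambda>" "1 / \<kappa> \<le> \<Lambda>"
    using eventually_happens'[OF trivial_limit_at_top_linorder] by blast
  define \<eta> where "\<eta> = \<delta> / (3 * \<Lambda> * (K + 1))"
  have "0 < \<eta>" using \<delta> \<Lambda> params by (simp add: \<eta>_def)
  moreover have "norm (U (r + 1 / \<Lambda>) r y) \<le> \<epsilon>" if y: "norm y \<le> b" and weak: "norm (R 0 r y) \<le> \<eta>" for r y
  proof -
    define v where "v s = U (r + s / \<Lambda>) r y" for s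
    have v_norm: "norm (v s) \<le> M * b" if "0 \<le> s" for s
    proof -
      have "norm (v s) \<le> M * norm y" unfolding v_def using that \<Lambda> by (intro U_apply) auto
      also have "\<dots> \<le> M * b" using y params by (intro mult_left_mono) auto
      finally show ?thesis .
    qed
    have v_deriv: "(v has_vector_derivative (1 / \<Lambda>) *\<^sub>R AU (r + s / \<Lambda>) r y) (at s)" if "0 < s" for s
      unfolding v_def
    proof (rule vector_diff_chain_at[of "\<lambda>s. r + s / \<Lambda>" "1 / \<Lambda>" s "\<lambda>q. U q r y", unfolded o_def])
      show "((\<lambda>s. r + s / \<Lambda>) has_vector_derivative 1 / \<Lambda>) (at s)"
        unfolding has_real_derivative_iff_has_vector_derivative[symmetric]
        using \<Lambda> by (auto intro!: derivative_eq_intros)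
      show "((\<lambda>q. U q r y) has_vector_derivative AU (r + s / \<Lambda>) r y) (at (r + s / \<Lambda>))"
        using that \<Lambda> by (intro U_deriv_apply) auto
    qed
    have cont: "continuous_on {0<..\<Lambda>} v"
      using v_deriv
      by (meson continuous_at_imp_continuous_on greaterThanAtMost_iff has_vector_derivative_continuous)
    have bnd: "norm (v s) \<le> 2 * M * b" if "s \<in> {0<..\<Lambda>}" for s
    proof -
      have "0 \<le> M * b" using params pos by simp
      then show ?thesis using v_norm[of s] that by simp
    qed
    \<comment> \<open>The chain rule factor 1/\<Lambda> cancels against the bound M \<Lambda> / q
      for the generator along the orbit, so the Lipschitz constant does not depend on
      \<Lambda>.\<close>
    have slow: "norm (v s - v 1) \<le> 2 * M * b * \<bar>s - 1\<bar>" if "s \<in> {1/2..2}" for s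
    proof -
      have "norm (v s - v 1) \<le> 2 * M * b * norm (s - 1)"
      proof (rule differentiable_bound[of "{1/2..2}" v "\<lambda>s h. h *\<^sub>R (1 / \<Lambda>) *\<^sub>R AU (r + s / \<Lambda>) r y"])
        show "(v has_derivative (\<lambda>h. h *\<^sub>R (1 / \<Lambda>) *\<^sub>R AU (r + q / \<Lambda>) r y)) (at q within {1/2..2})"
          if "q \<in> {1/2..2}" for q
          using v_deriv[of q] that
          by (auto simp: has_vector_derivative_def intro: has_derivative_at_withinI)
        show "onorm (\<lambda>h. h *\<^sub>R (1 / \<Lambda>) *\<^sub>R AU (r + q / \<Lambda>) r y) \<le> 2 * M * b"
          if q: "q \<in> {1/2..2}" for q
        proof (rule onorm_le)
          fix h :: real
          have "norm (AU (r + q / \<Lambda>) r y) \<le> M / (q / \<Lambda>) * norm y"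
            using AU_apply[of r "r + q / \<Lambda>" y] q \<Lambda> by simp
          also have "\<dots> \<le> M / (q / \<Lambda>) * b" using y q \<Lambda> params by (intro mult_left_mono) auto
          finally have "1 / \<Lambda> * norm (AU (r + q / \<Lambda>) r y) \<le> 1 / \<Lambda> * (M / (q / \<Lambda>) * b)"
            using \<Lambda> by (intro mult_left_mono) auto
          also have "\<dots> = (M * b) * (1 / q)" using \<Lambda> by simp
          also have "\<dots> \<le> (M * b) * 2"
            using q params pos by (intro mult_left_mono) (auto simp: field_simps)
          finally have "\<bar>h\<bar> * (1 / \<Lambda> * norm (AU (r + q / \<Lambda>) r y)) \<le> \<bar>h\<bar> * ((M * b) * 2)"
            by (intro mult_left_mono) auto
          then show "norm (h *\<^sub>R (1 / \<Lambda>) *\<^sub>R AU (r + q / \<Lambda>) r y) \<le> 2 * M * b * norm h"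
            using \<Lambda> by (simp add: mult_ac)
        qed
      qed (use that in auto)
      then show ?thesis by simp
    qed
    have "norm (integral {0..\<Lambda>} (\<lambda>s. exp (- (real (Suc j) * s)) *\<^sub>R v s)) \<le> \<delta>" for j
    proof -
      define J where "J = real (Suc j)"
      \<comment> \<open>The Laplace variable J in rescaled time is J \<Lambda> in original
        time.\<close>
      define l where "l = J * \<Lambda>"
      have J: "1 \<le> J" by (simp add: J_def)
      then have "1 * \<Lambda> \<le> l" unfolding l_def using \<Lambda> by (intro mult_right_mono) auto
      then have l: "\<Lambda> \<le> l" "0 < l" "0 \<le> l" using \<Lambda> by auto
      define Z where "Z s = \<Lambda> *\<^sub>R exp (- (J * s)) *\<^sub>R R l r (v s)" for s
      define Z' where "Z' s = exp (- (J * s)) *\<^sub>R (R l r (AU (r + s / \<Lambda>) r y) - l *\<^sub>R R l r (v s))" for s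
      have "(Z' has_integral (Z \<Lambda> - Z 0)) {0..\<Lambda>}"
      proof (rule fundamental_theorem_of_calculus_interior)
        have "continuous_on {0..\<Lambda>} (\<lambda>s. R l r (v s))"
          unfolding v_def
          by (rule continuous_on_compose2[OF R_U_cont[of l r "r + 1" y], of _ "\<lambda>s. r + s / \<Lambda>"])
            (use l \<Lambda> in \<open>auto intro!: continuous_intros\<close>)
        then show "continuous_on {0..\<Lambda>} Z"
          unfolding Z_def by (intro continuous_intros)
        fix s assume s: "s \<in> {0<..<\<Lambda>}"
        have 1: "((\<lambda>s. R l r (v s)) has_vector_derivative R l r ((1 / \<Lambda>) *\<^sub>R AU (r + s / \<Lambda>) r y)) (at s)"
          using s l by (intro bounded_linear.has_vector_derivative[OF R_linear] v_deriv) auto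
        have 2: "((\<lambda>s. exp (- (J * s))) has_real_derivative (- J * exp (- (J * s)))) (at s)"
          by (auto intro!: derivative_eq_intros)
        from has_vector_derivative_scaleR[OF 2 1]
        have "((\<lambda>s. \<Lambda> *\<^sub>R exp (- (J * s)) *\<^sub>R R l r (v s)) has_vector_derivative
          \<Lambda> *\<^sub>R (exp (- (J * s)) *\<^sub>R R l r ((1 / \<Lambda>) *\<^sub>R AU (r + s / \<Lambda>) r y) + (- J * exp (- (J * s))) *\<^sub>R R l r (v s))) (at s)"
          by (intro bounded_linear.has_vector_derivative[OF bounded_linear_scaleR_right])
        also have "\<Lambda> *\<^sub>R (exp (- (J * s)) *\<^sub>R R l r ((1 / \<Lambda>) *\<^sub>R AU (r + s / \<Lambda>) r y) + (- J * exp (- (J * s))) *\<^sub>R R l r (v s)) = Z' s"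
          using \<Lambda> l by (simp add: Z'_def R_scale algebra_simps l_def)
        finally show "(Z has_vector_derivative Z' s) (at s)" unfolding Z_def .
      qed (use \<Lambda> in auto)
      moreover have "(\<lambda>s. exp (- (J * s)) *\<^sub>R v s) integrable_on {0..\<Lambda>}"
      proof (rule integrable_on_bounded_continuous_left)
        show "continuous_on {0<..\<Lambda>} (\<lambda>s. exp (- (J * s)) *\<^sub>R v s)"
          by (intro continuous_intros cont)
        show "norm (exp (- (J * s)) *\<^sub>R v s) \<le> 1 * (M * b)" if "s \<in> {0<..\<Lambda>}" for s
        proof -
          have "exp (- (J * s)) * norm (v s) \<le> 1 * (M * b)"
            using that J v_norm[of s] by (intro mult_mono) auto
          then show ?thesis by simp
        qed
      qed
      ultimately have "((\<lambda>s. Z' s + exp (- (J * s)) *\<^sub>R v s) has_integral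
          (Z \<Lambda> - Z 0 + integral {0..\<Lambda>} (\<lambda>s. exp (- (J * s)) *\<^sub>R v s))) {0..\<Lambda>}"
        by (intro has_integral_add) (auto intro: integrable_integral)
      \<comment> \<open>At s = 0 the integrand contains \<open>AU r r\<close>, which is
        unconstrained, so this point is discarded.\<close>
      then have tot: "((\<lambda>s. if s = 0 then 0 else Z' s + exp (- (J * s)) *\<^sub>R v s) has_integral
          (Z \<Lambda> - Z 0 + integral {0..\<Lambda>} (\<lambda>s. exp (- (J * s)) *\<^sub>R v s))) {0..\<Lambda>}"
        by (rule has_integral_spike[rotated 2, where S = "{0}"]) auto
      have g1: "((\<lambda>s. exp (- s)) has_integral (- exp (- \<Lambda>) - (- exp (- 0)))) {0..\<Lambda>}"
        using \<Lambda> by (intro fundamental_theorem_of_calculus)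
          (auto intro!: derivative_eq_intros simp: has_real_derivative_iff_has_vector_derivative[symmetric])
      have G: "(\<lambda>s. s powr (\<mu> - 1) / exp s) integrable_on {0..}"
        using Gamma_integral_real[of \<mu>] params by blast
      have g2: "(\<lambda>s. s powr (\<mu> - 1) / exp s) integrable_on {0..\<Lambda>}"
        by (rule integrable_on_subinterval[OF G]) auto
      have g2_le: "integral {0..\<Lambda>} (\<lambda>s. s powr (\<mu> - 1) / exp s) \<le> Gamma \<mu>"
        using integral_subset_le[OF _ g2 G] Gamma_integral_real[of \<mu>] params
        by (auto simp: integral_unique)
      have "norm (integral {0..\<Lambda>} (\<lambda>s. if s = 0 then 0 else Z' s + exp (- (J * s)) *\<^sub>R v s))
          \<le> integral {0..\<Lambda>} (\<lambda>s. c * \<Lambda> powr (- \<theta>) * (exp (- s) + s powr (\<mu> - 1) / exp s))"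
      proof (rule Henstock_Kurzweil_Integration.integral_norm_bound_integral)
        show "(\<lambda>s. if s = 0 then 0 else Z' s + exp (- (J * s)) *\<^sub>R v s) integrable_on {0..\<Lambda>}"
          using tot by blast
        show "(\<lambda>s. c * \<Lambda> powr (- \<theta>) * (exp (- s) + s powr (\<mu> - 1) / exp s)) integrable_on {0..\<Lambda>}"
          using g1 g2 by (intro integrable_on_mult_right integrable_add) auto
        fix s assume s: "s \<in> {0..\<Lambda>}"
        show "norm (if s = 0 then 0 else Z' s + exp (- (J * s)) *\<^sub>R v s)
            \<le> c * \<Lambda> powr (- \<theta>) * (exp (- s) + s powr (\<mu> - 1) / exp s)"
        proof (cases "s = 0")
          case True
          then show ?thesis using c by simp
        next
          case False
          then have s: "0 < s" "s \<le> \<Lambda>" using s by auto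
          let ?q = "r + s / \<Lambda>"
          let ?b = "B ?q (v s)"
          have q: "r < ?q" "?q \<le> r + 1" using s \<Lambda> by auto
          have D: "v s \<in> D ?q" unfolding v_def using q by (intro U_mem)
          have e1: "norm (w *\<^sub>R R l r (v s)) \<le> c * \<Lambda> powr (- \<theta>)"
          proof -
            have "norm (R l r (v s)) \<le> K / (1 + l) * norm (v s)" using l by (intro R_norm)
            also have "\<dots> \<le> K / (1 + l) * (M * b)"
              using l s params v_norm[of s] by (intro mult_left_mono) auto
            finally have "w * norm (R l r (v s)) \<le> w * (K / (1 + l) * (M * b))"
              using params by (intro mult_left_mono) auto
            then have "norm (w *\<^sub>R R l r (v s)) \<le> w * (K / (1 + l) * (M * b))"
              using params by simp
            also have "\<dots> = w * K * M * b * (1 / (1 + l))" by simp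
            also have "\<dots> \<le> (1 + w) * K * M * b * \<Lambda> powr (- \<theta>)"
            proof (intro mult_mono)
              have "1 / (1 + l) \<le> 1 / \<Lambda>" using l \<Lambda> by (intro divide_left_mono) auto
              also have "\<dots> = \<Lambda> powr (- 1)" using \<Lambda> by (simp add: powr_minus_divide)
              also have "\<dots> \<le> \<Lambda> powr (- \<theta>)" using \<theta> \<Lambda> by (intro powr_mono) auto
              finally show "1 / (1 + l) \<le> \<Lambda> powr (- \<theta>)" .
            qed (use params pos l in auto)
            finally show ?thesis by (simp add: c_def mult_ac)
          qed
          \<comment> \<open>The powers of s/\<Lambda> are \<mu> from the distance of the two times
            and -1 from the smoothing bound. Together with \<Lambda> powr (- \<nu>) they give
            \<Lambda> powr (1 - \<mu> - \<nu>) times the integrable s powr (\<mu> - 1).\<close>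
          have e2: "norm (R l r ?b - (l *\<^sub>R R l r (v s) - v s)) \<le> c * \<Lambda> powr (- \<theta>) * s powr (\<mu> - 1)"
          proof -
            have "norm (R l r ?b - (l *\<^sub>R R l r (v s) - v s)) \<le> K * \<bar>r - ?q\<bar> powr \<mu> * l powr (- \<nu>) * norm ?b"
              by (rule R_B[OF l(2) D])
            also have "\<dots> \<le> K * (s / \<Lambda>) powr \<mu> * \<Lambda> powr (- \<nu>) * (M * (1 + w) / (s / \<Lambda>) * b)"
            proof (intro mult_mono)
              show "l powr (- \<nu>) \<le> \<Lambda> powr (- \<nu>)" using l \<Lambda> params by (intro powr_mono2') auto
              have "norm ?b \<le> M * (1 + w) / (?q - r) * norm y"
                unfolding v_def by (rule BU_apply[OF q])
              also have "\<dots> \<le> M * (1 + w) / (?q - r) * b"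
                using y params s \<Lambda> by (intro mult_left_mono) auto
              finally show "norm ?b \<le> M * (1 + w) / (s / \<Lambda>) * b" by simp
            qed (use s \<Lambda> params in auto)
            also have "\<dots> = c * \<Lambda> powr (- \<theta>) * s powr (\<mu> - 1)"
proof -
              have "\<Lambda> powr (- \<theta>) = \<Lambda> powr (1 - \<mu> - \<nu>)" by (simp add: \<theta>_def diff_diff_eq)
              also have "\<dots> = \<Lambda> / \<Lambda> powr \<mu> * \<Lambda> powr (- \<nu>)"
                using \<Lambda> by (simp add: powr_diff powr_minus_divide)
              finally show ?thesis
                using s \<Lambda> by (simp add: c_def powr_divide powr_diff)
            qed
            finally show ?thesis .
          qed
          have "R l r (AU ?q r y) = R l r ?b + w *\<^sub>R R l r (v s)"
            using q l by (simp add: AU_eq v_def R_add R_scale)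
          then have "Z' s + exp (- (J * s)) *\<^sub>R v s =
              exp (- (J * s)) *\<^sub>R (w *\<^sub>R R l r (v s) + (R l r ?b - (l *\<^sub>R R l r (v s) - v s)))"
            by (simp add: Z'_def algebra_simps)
          also have "norm \<dots> \<le> exp (- s) * (c * \<Lambda> powr (- \<theta>) + c * \<Lambda> powr (- \<theta>) * s powr (\<mu> - 1))"
            unfolding norm_scaleR
          proof (intro mult_mono order_trans[OF norm_triangle_ineq] add_mono e1 e2)
            have "1 * s \<le> J * s" using J s by (intro mult_right_mono) auto
            then show "\<bar>exp (- (J * s))\<bar> \<le> exp (- s)" by simp
          qed auto
          also have "\<dots> = c * \<Lambda> powr (- \<theta>) * (exp (- s) + s powr (\<mu> - 1) / exp s)"
            by (simp add: algebra_simps exp_minus inverse_eq_divide)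
          finally show ?thesis using False by simp
        qed
      qed
      also have "\<dots> = c * \<Lambda> powr (- \<theta>) * (integral {0..\<Lambda>} (\<lambda>s. exp (- s)) + integral {0..\<Lambda>} (\<lambda>s. s powr (\<mu> - 1) / exp s))"
        using g1 g2 by (subst Henstock_Kurzweil_Integration.integral_mult_right)
          (auto simp: Henstock_Kurzweil_Integration.integral_add has_integral_integrable)
      also have "\<dots> \<le> c * \<Lambda> powr (- \<theta>) * (1 + Gamma \<mu>)"
        using c g2_le g1 by (intro mult_left_mono add_mono) (auto simp: integral_unique)
      also have "\<dots> = c1 * \<Lambda> powr (- \<theta>)" by (simp add: c1_def mult_ac)
      finally have small: "norm (Z \<Lambda> - Z 0 + integral {0..\<Lambda>} (\<lambda>s. exp (- (J * s)) *\<^sub>R v s)) \<le> \<delta> / 3"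
        using \<Lambda> integral_unique[OF tot] by simp
      \<comment> \<open>The only place where weak smallness of y enters.\<close>
      have Z0: "norm (Z 0) \<le> \<delta> / 3"
      proof -
        have "norm (Z 0) \<le> \<Lambda> * ((K + 1) * norm (R 0 r y))"
          using R_norm_R0[of l r y] l \<Lambda> by (auto simp: Z_def v_def U_refl intro!: mult_left_mono)
        also have "\<dots> \<le> \<Lambda> * ((K + 1) * \<eta>)"
          using weak \<Lambda> params by (intro mult_left_mono) auto
        also have "\<dots> = \<delta> / 3" using \<Lambda> params by (simp add: \<eta>_def)
        finally show ?thesis .
      qed
      have Z1: "norm (Z \<Lambda>) \<le> \<delta> / 3"
      proof -
        have "norm (Z \<Lambda>) = exp (- (J * \<Lambda>)) * (\<Lambda> * norm (R l r (v \<Lambda>)))"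
          using \<Lambda> by (simp add: Z_def)
        also have "\<dots> \<le> exp (- \<Lambda>) * (K * M * b)"
        proof (rule mult_mono)
          show "exp (- (J * \<Lambda>)) \<le> exp (- \<Lambda>)" using l by (simp add: l_def)
          have "\<Lambda> * norm (R l r (v \<Lambda>)) \<le> \<Lambda> * (K / (1 + l) * (M * b))"
            using R_norm[of l r "v \<Lambda>"] v_norm[of \<Lambda>] l \<Lambda> params
            by (intro mult_left_mono order_trans[OF R_norm] mult_left_mono) auto
          also have "\<dots> = (\<Lambda> / (1 + l)) * (K * M * b)" by simp
          also have "\<dots> \<le> 1 * (K * M * b)"
            using l \<Lambda> params pos by (intro mult_right_mono) auto
          finally show "\<Lambda> * norm (R l r (v \<Lambda>)) \<le> K * M * b" by simp
        qed (use \<Lambda> in auto)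
        also have "\<dots> \<le> \<delta> / 3" using \<Lambda> by (simp add: mult_ac)
        finally show ?thesis .
      qed
      let ?I = "integral {0..\<Lambda>} (\<lambda>s. exp (- (J * s)) *\<^sub>R v s)"
      have "norm ?I = norm ((Z \<Lambda> - Z 0 + ?I) + Z 0 - Z \<Lambda>)" by simp
      also have "\<dots> \<le> \<delta> / 3 + \<delta> / 3 + \<delta> / 3"
        by (intro order_trans[OF norm_triangle_ineq4] order_trans[OF norm_triangle_ineq] add_mono small Z0 Z1)
      finally show ?thesis by (simp add: J_def)
    qed
    with taub \<Lambda>(3) cont bnd slow have "norm (v 1) \<le> \<epsilon>" by blast
    then show ?thesis by (simp add: v_def)
  qed
  moreover have "1 / \<Lambda> \<le> \<kappa>" using \<Lambda> pos by (simp add: field_simps)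
  ultimately show ?thesis using \<Lambda> by (intro exI[of _ "1 / \<Lambda>"] exI[of _ \<eta>]) simp
qed

section \<open>Uniform norm continuity in either variable\<close>

text \<open>The difference is - \<open>U t s\<close> applied to y =
  \<open>U s (s - h) z - z\<close>, which is bounded by M + 1 and weakly small. A time k \<le>
  \<kappa> after s it is small in norm, and the remaining evolution costs a factor M.\<close>

lemma U_right_uniform:
  assumes "0 < \<epsilon>" "0 < \<kappa>"
  shows "\<exists>h0>0. \<forall>t s h. 0 \<le> h \<longrightarrow> h \<le> h0 \<longrightarrow> s + \<kappa> \<le> t \<longrightarrow> norm (U t s - U t (s - h)) \<le> \<epsilon>"
proof -
  have "0 < \<epsilon> / M" "0 < M + 1" using assms params by auto
  from weak_small[OF this(1) assms(2) this(2)]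
  obtain k \<eta> where k: "0 < k" "k \<le> \<kappa>" "0 < \<eta>"
    "\<forall>r y. norm y \<le> M + 1 \<longrightarrow> norm (R 0 r y) \<le> \<eta> \<longrightarrow> norm (U (r + k) r y) \<le> \<epsilon> / M"
    by (elim exE conjE)
  have "((\<lambda>h. weak_modulus * h powr \<mu>) \<longlongrightarrow> 0) (at_right 0)"
    by (intro tendsto_mult_right_zero tendsto_zero_powrI[OF _ tendsto_const]) (use params in \<open>auto simp: eventually_at_right_less intro: eventually_at_rightI[of 0 1]\<close>)
  then have "eventually (\<lambda>h. weak_modulus * h powr \<mu> < \<eta>) (at_right 0)"
    using k by (auto intro: order_tendstoD)
  then obtain h1 where h1: "0 < h1" "\<And>h. 0 < h \<Longrightarrow> h < h1 \<Longrightarrow> weak_modulus * h powr \<mu> < \<eta>"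
    by (auto simp: eventually_at_right_field)
  show ?thesis
  proof (intro exI[of _ "min 1 (h1 / 2)"] conjI allI impI)
    fix t s h assume h: "0 \<le> h" "h \<le> min 1 (h1 / 2)" and t: "s + \<kappa> \<le> t"
    show "norm (U t s - U t (s - h)) \<le> \<epsilon>"
    proof (cases "h = 0")
      case True
      then show ?thesis using assms by simp
    next
      case False
      then have h: "0 < h" "h \<le> 1" "h < h1" using h h1 by auto
      show ?thesis
      proof (rule norm_blinfun_bound)
        fix x :: 'a
        \<comment> \<open>Normalisation by \<open>sgn\<close> puts y in one fixed ball, so that the
          same \<eta> serves for all x; the value 0 at x = 0 is harmless.\<close>
        define z where "z = sgn x"
        have z: "norm z \<le> 1" by (simp add: z_def norm_sgn)
        define y where "y = U s (s - h) z - z"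
        have "norm y \<le> norm (U s (s - h) z) + norm z" unfolding y_def by (rule norm_triangle_ineq4)
        also have "\<dots> \<le> M * norm z + norm z" using U_apply[of "s - h" s z] h by simp
        also have "\<dots> \<le> M * 1 + 1" using z params by (intro add_mono mult_left_mono) auto
        finally have y: "norm y \<le> M + 1" by simp
        have "norm (R 0 s y) \<le> weak_modulus * h powr \<mu> * norm z"
          using weak_continuity[of h "s - h" z] h by (simp add: y_def)
        also have "\<dots> \<le> \<eta> * 1" using h1(2)[of h] h z k by (intro mult_mono) auto
        finally have "norm (U (s + k) s y) \<le> \<epsilon> / M" using y k by simp
        then have "M * norm (U (s + k) s y) \<le> M * (\<epsilon> / M)"
          using params by (intro mult_left_mono) auto
        then have *: "M * norm (U (s + k) s y) \<le> \<epsilon>" using params by simp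
        have "(U t s - U t (s - h)) z = - U t s y"
          using U_trans[of "s - h" s t] h t assms by (simp add: y_def blinfun.diff_left blinfun.diff_right)
        also have "\<dots> = - U t (s + k) (U (s + k) s y)"
          using U_trans[of s "s + k" t] k t by simp
        finally have "norm ((U t s - U t (s - h)) z) \<le> \<epsilon>"
          using U_apply[of "s + k" t "U (s + k) s y"] * k t by simp
        then have "norm x * norm ((U t s - U t (s - h)) z) \<le> norm x * \<epsilon>"
          by (intro mult_left_mono) auto
        moreover have "(U t s - U t (s - h)) x = norm x *\<^sub>R (U t s - U t (s - h)) z"
          by (cases "x = 0") (simp_all add: z_def sgn_div_norm blinfun.scaleR_right)
        ultimately show "norm ((U t s - U t (s - h)) x) \<le> \<epsilon> * norm x"
          by (simp add: mult.commute)
      qed (use assms in auto)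
    qed
  qed (use h1 in auto)
qed

text \<open>The bound on the derivative holds only for time differences up to 1, so the evolution is
  factored through t - k. One factor M comes from the derivative, the other from
  \<open>U (t - k) s\<close>.\<close>

lemma U_left_uniform:
  assumes "0 < \<epsilon>" "0 < \<kappa>"
  shows "\<exists>h0>0. \<forall>t s h. 0 \<le> h \<longrightarrow> h \<le> h0 \<longrightarrow> s + \<kappa> \<le> t \<longrightarrow> norm (U (t + h) s - U t s) \<le> \<epsilon>"
proof -
  \<comment> \<open>With h \<le> 1/2 as well, all elapsed times since t - k stay between k and
    1.\<close>
  define k where "k = min \<kappa> (1 / 2)"
  have k: "0 < k" "k \<le> \<kappa>" "k \<le> 1 / 2" using assms by (auto simp: k_def)
  show ?thesis
  proof (intro exI[of _ "min (1 / 2) (\<epsilon> * k / M\<^sup>2)"] conjI allI impI)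
    fix t s h assume h: "0 \<le> h" "h \<le> min (1 / 2) (\<epsilon> * k / M\<^sup>2)" and t: "s + \<kappa> \<le> t"
    show "norm (U (t + h) s - U t s) \<le> \<epsilon>"
    proof (cases "h = 0")
      case True
      then show ?thesis using assms by simp
    next
      case False
      have "norm (U (t + h) (t - k) - U t (t - k)) \<le> M / k * (t + h) - M / k * t"
      proof (rule differentiable_bound_general)
        have "continuous_on {t - k<..} (\<lambda>r. U r (t - k))"
          using U_deriv
          by (meson continuous_at_imp_continuous_on greaterThan_iff has_vector_derivative_continuous)
        then show "continuous_on {t..t + h} (\<lambda>r. U r (t - k))"
          by (rule continuous_on_subset) (use k in auto)
        show "continuous_on {t..t + h} (\<lambda>r. M / k * r)" by (intro continuous_intros)
        fix r assume r: "t < r" "r < t + h"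
        show "((\<lambda>r. U r (t - k)) has_vector_derivative AU r (t - k)) (at r)"
          using r k by (intro U_deriv) auto
        show "((*) (M / k) has_vector_derivative M / k) (at r)"
          unfolding has_real_derivative_iff_has_vector_derivative[symmetric]
          by (auto intro!: derivative_eq_intros)
        have "norm (AU r (t - k)) \<le> M / (r - (t - k))"
          using r k h by (intro AU_norm) auto
        also have "\<dots> \<le> M / k" using r k params by (intro divide_left_mono) auto
        finally show "norm (AU r (t - k)) \<le> M / k" .
      qed (use h False in auto)
      also have "\<dots> = M / k * h" by (simp add: distrib_left)
      finally have 1: "norm (U (t + h) (t - k) - U t (t - k)) \<le> M / k * h" .
      have "U (t + h) s - U t s = (U (t + h) (t - k) - U t (t - k)) o\<^sub>L U (t - k) s"
        using U_trans[of s "t - k" t] U_trans[of s "t - k" "t + h"] k t h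
        by (simp add: bounded_bilinear.diff_left[OF bounded_bilinear_blinfun_compose])
      also have "norm \<dots> \<le> norm (U (t + h) (t - k) - U t (t - k)) * norm (U (t - k) s)"
        by (rule norm_blinfun_compose)
      also have "\<dots> \<le> (M / k * h) * M"
        using 1 U_norm[of s "t - k"] k t params h by (intro mult_mono) auto
      also have "\<dots> = h * (M\<^sup>2 / k)" by (simp add: power2_eq_square)
      also have "\<dots> \<le> (\<epsilon> * k / M\<^sup>2) * (M\<^sup>2 / k)"
        using h k by (intro mult_right_mono) auto
      also have "\<dots> = \<epsilon>" using k params by simp
      finally show ?thesis .
    qed
  qed (use assms k params in auto)
qed

end

section \<open>Quasi-periods of stable evolution systems\<close>

lemma has_integral_exp_decay:
  fixes a c t :: real
  assumes "0 < a" "c \<le> t"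
  shows "((\<lambda>s. exp (- a * (t - s))) has_integral (1 - exp (- a * (t - c))) / a) {c..t}"
proof -
  have "((\<lambda>s. exp (- a * (t - s))) has_integral exp (- a * (t - t)) / a - exp (- a * (t - c)) / a) {c..t}"
    using assms by (intro fundamental_theorem_of_calculus)
      (auto intro!: derivative_eq_intros simp: has_real_derivative_iff_has_vector_derivative[symmetric])
  then show ?thesis by (simp add: diff_divide_distrib)
qed

lemma integral_exp_decay:
  fixes a c t :: real
  assumes "0 < a" "c \<le> t"
  shows "integral {c..t} (\<lambda>s. exp (- a * (t - s))) \<le> 1 / a"
  unfolding integral_unique[OF has_integral_exp_decay[OF assms]] using assms by (intro divide_right_mono) auto

lemma integral_reflect_Icc_0:
  fixes f :: "real \<Rightarrow> 'a::banach"
  shows "integral {0..t} (\<lambda>s. f (t - s)) = integral {0..t} f"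
proof -
  have "integral {0..t} (\<lambda>s. f (t - s)) = integral {- t..0} (\<lambda>s. f (- s))"
    using integral_shift_Icc_real[of 0 t "\<lambda>s. f (- s)" "- t"] by (simp add: o_def)
  also have "\<dots> = integral {0..t} f"
    using Henstock_Kurzweil_Integration.integral_reflect_real[of t 0 f] by simp
  finally show ?thesis .
qed

text \<open>
  Bohr's pigeonhole argument: the gaps between nearby elements of two relatively dense sets form a
  totally bounded set, so differences of elements of the two sets nearly coincide.
\<close>

lemma relatively_dense_differences:
  fixes P Q :: "real \<Rightarrow> bool"
  assumes "0 < l" "\<And>a. 0 \<le> a \<Longrightarrow> \<exists>\<tau>\<in>{a..a + l}. P \<tau>"
    and "0 < l'" "\<And>a. 0 \<le> a \<Longrightarrow> \<exists>\<sigma>\<in>{a..a + l'}. Q \<sigma>" and "0 < \<delta>"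
  shows "\<exists>N>0. \<forall>a\<ge>0. \<exists>\<tau>\<^sub>1 \<tau>\<^sub>2 \<sigma>\<^sub>1 \<sigma>\<^sub>2. P \<tau>\<^sub>1 \<and> P \<tau>\<^sub>2 \<and> Q \<sigma>\<^sub>1 \<and> Q \<sigma>\<^sub>2 \<and>
    \<tau>\<^sub>1 - \<tau>\<^sub>2 \<in> {a..a + N} \<and> \<bar>(\<tau>\<^sub>1 - \<tau>\<^sub>2) - (\<sigma>\<^sub>1 - \<sigma>\<^sub>2)\<bar> \<le> \<delta>"
proof -
  define m where "m = max l l'"
  have "\<exists>\<tau>. P \<tau> \<and> a \<le> \<tau> \<and> \<tau> \<le> a + m" "\<exists>\<sigma>. Q \<sigma> \<and> a \<le> \<sigma> \<and> \<sigma> \<le> a + m" if "0 \<le> a" for a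
    using assms(2,4)[OF that] by (force simp: m_def)+
  then obtain \<tau> \<sigma> where \<tau>: "\<And>a. 0 \<le> a \<Longrightarrow> P (\<tau> a) \<and> a \<le> \<tau> a \<and> \<tau> a \<le> a + m"
    and \<sigma>: "\<And>a. 0 \<le> a \<Longrightarrow> Q (\<sigma> a) \<and> a \<le> \<sigma> a \<and> \<sigma> a \<le> a + m"
    by metis
  define d where "d a = \<tau> a - \<sigma> a" for a
  have "d a \<in> {- m..m}" if "0 \<le> a" for a using \<tau>[OF that] \<sigma>[OF that] by (auto simp: d_def)
  then have "d ` {0..} \<subseteq> {- m..m}" by auto
  then have "bounded (d ` {0..})" by (rule bounded_subset[rotated]) simp
  then have "compact (closure (d ` {0..}))" by (simp add: compact_closure)
  \<comment> \<open>The balls are centred at gaps d b that actually occur, so each centre comes with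
    a pair of elements, one from each set, located near b.\<close>
  moreover have "closure (d ` {0..}) \<subseteq> (\<Union>b\<in>{0..}. ball (d b) \<delta>)"
  proof
    fix x assume "x \<in> closure (d ` {0..})"
    then obtain b where "b \<in> {0..}" "dist (d b) x < \<delta>"
      using assms(5) by (auto simp: closure_approachable)
    then show "x \<in> (\<Union>b\<in>{0..}. ball (d b) \<delta>)" by auto
  qed
  ultimately obtain S where S: "S \<subseteq> {0..}" "finite S" "closure (d ` {0..}) \<subseteq> (\<Union>b\<in>S. ball (d b) \<delta>)"
    using compactE_image[of "closure (d ` {0..})" "{0..}" "\<lambda>b. ball (d b) \<delta>"] by auto
  define B where "B = Max (insert 0 S)"
  have B: "0 \<le> B" "\<And>b. b \<in> S \<Longrightarrow> b \<le> B" using S by (auto simp: B_def)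
  show ?thesis
  proof (rule exI[of _ "B + 2 * m"], intro conjI allI impI)
    show "0 < B + 2 * m" using B assms by (auto simp: m_def)
    fix a :: real assume a: "0 \<le> a"
    \<comment> \<open>Going beyond every representative b \<le> B by at least a + m ensures \<tau> c
      - \<tau> b \<ge> a, since \<tau> b \<le> B + m.\<close>
    define c where "c = a + B + m"
    have c: "0 \<le> c" using a B assms by (simp add: c_def m_def)
    then have "d c \<in> closure (d ` {0..})" using closure_subset[of "d ` {0..}"] by auto
    then obtain b where b: "b \<in> S" "dist (d b) (d c) < \<delta>" using S by auto
    then have b0: "0 \<le> b" using S by auto
    show "\<exists>\<tau>\<^sub>1 \<tau>\<^sub>2 \<sigma>\<^sub>1 \<sigma>\<^sub>2. P \<tau>\<^sub>1 \<and> P \<tau>\<^sub>2 \<and> Q \<sigma>\<^sub>1 \<and> Q \<sigma>\<^sub>2 \<and>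
      \<tau>\<^sub>1 - \<tau>\<^sub>2 \<in> {a..a + (B + 2 * m)} \<and> \<bar>(\<tau>\<^sub>1 - \<tau>\<^sub>2) - (\<sigma>\<^sub>1 - \<sigma>\<^sub>2)\<bar> \<le> \<delta>"
    proof (rule exI[of _ "\<tau> c"], rule exI[of _ "\<tau> b"], rule exI[of _ "\<sigma> c"], rule exI[of _ "\<sigma> b"], intro conjI)
      show "\<tau> c - \<tau> b \<in> {a..a + (B + 2 * m)}"
        using \<tau>[OF c] \<tau>[OF b0] B(2)[OF b(1)] b0 by (auto simp: c_def)
      show "\<bar>(\<tau> c - \<tau> b) - (\<sigma> c - \<sigma> b)\<bar> \<le> \<delta>"
        using b(2) by (auto simp: d_def dist_real_def)
    qed (use \<tau> \<sigma> c b0 in auto)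
  qed
qed

text \<open>Collects what the parabolic theory hands over to the fixed point and quasi-period
  arguments: exponential decay, and norm continuity in each variable, uniform away from the
  diagonal.\<close>

locale stable_evolution =
  fixes U :: "real \<Rightarrow> real \<Rightarrow> 'a::banach \<Rightarrow>\<^sub>L 'a" and M \<omega> :: real
  assumes pos: "0 < M" "0 < \<omega>"
    and U_refl: "U s s = id_blinfun"
    and U_trans: "s \<le> r \<Longrightarrow> r \<le> t \<Longrightarrow> U t s = U t r o\<^sub>L U r s"
    and decay: "s \<le> t \<Longrightarrow> norm (U t s) \<le> M * exp (- \<omega> * (t - s))"
    and left_uniform: "0 < \<epsilon> \<Longrightarrow> 0 < \<kappa> \<Longrightarrow>
      \<exists>h0>0. \<forall>t s h. 0 \<le> h \<longrightarrow> h \<le> h0 \<longrightarrow> s + \<kappa> \<le> t \<longrightarrow> norm (U (t + h) s - U t s) \<le> \<epsilon>"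
    and right_uniform: "0 < \<epsilon> \<Longrightarrow> 0 < \<kappa> \<Longrightarrow>
      \<exists>h0>0. \<forall>t s h. 0 \<le> h \<longrightarrow> h \<le> h0 \<longrightarrow> s + \<kappa> \<le> t \<longrightarrow> norm (U t s - U t (s - h)) \<le> \<epsilon>"
begin

lemma norm_le: "s \<le> t \<Longrightarrow> norm (U t s) \<le> M"
  using mult_left_mono[of "exp (- \<omega> * (t - s))" 1 M] pos
  by (intro order_trans[OF decay]) auto

lemma apply_decay: "s \<le> t \<Longrightarrow> norm (U t s x) \<le> M * exp (- \<omega> * (t - s)) * norm x"
  by (rule order_trans[OF norm_blinfun mult_right_mono[OF decay]]) auto

lemma apply_le: "s \<le> t \<Longrightarrow> norm (U t s x) \<le> M * norm x"
  by (rule order_trans[OF norm_blinfun mult_right_mono[OF norm_le]]) auto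

lemma apply_le': "s \<le> t \<Longrightarrow> norm x \<le> b \<Longrightarrow> norm (U t s x) \<le> M * b"
  using pos by (intro order_trans[OF apply_le] mult_left_mono) auto

lemma continuous_right: "continuous_on {..<t} (\<lambda>s. U t s)"
  unfolding continuous_on_iff
proof (intro ballI allI impI)
  fix s e :: real assume s: "s \<in> {..<t}" and e: "0 < e"
  define \<kappa> where "\<kappa> = (t - s) / 2"
  have \<kappa>: "0 < \<kappa>" "t = s + 2 * \<kappa>" using s by (auto simp: \<kappa>_def field_simps)
  from right_uniform[OF half_gt_zero[OF e] \<kappa>(1)] obtain h0 where h0: "0 < h0"
    "\<And>t s h. 0 \<le> h \<Longrightarrow> h \<le> h0 \<Longrightarrow> s + \<kappa> \<le> t \<Longrightarrow> norm (U t s - U t (s - h)) \<le> e / 2" by metis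
  show "\<exists>d>0. \<forall>s'\<in>{..<t}. dist s' s < d \<longrightarrow> dist (U t s') (U t s) < e"
  proof (intro exI[of _ "min h0 \<kappa>"] conjI ballI impI)
    fix s' assume s': "s' \<in> {..<t}" "dist s' s < min h0 \<kappa>"
    have "norm (U t s' - U t s) \<le> e / 2"
    proof (cases "s' \<le> s")
      case True
      then show ?thesis using h0(2)[of "s - s'" s t] s' \<kappa> by (simp add: dist_real_def norm_minus_commute)
    next
      case False
      then show ?thesis using h0(2)[of "s' - s" s' t] s' \<kappa> by (simp add: dist_real_def)
    qed
    then show "dist (U t s') (U t s) < e" using e by (simp add: dist_norm)
  qed (use h0 \<kappa> in auto)
qed

lemma continuous_left: "continuous_on {s<..} (\<lambda>t. U t s)"
  unfolding continuous_on_iff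
proof (intro ballI allI impI)
  fix t e :: real assume t: "t \<in> {s<..}" and e: "0 < e"
  define \<kappa> where "\<kappa> = (t - s) / 2"
  have \<kappa>: "0 < \<kappa>" "t = s + 2 * \<kappa>" using t by (auto simp: \<kappa>_def field_simps)
  from left_uniform[OF half_gt_zero[OF e] \<kappa>(1)] obtain h0 where h0: "0 < h0"
    "\<And>t s h. 0 \<le> h \<Longrightarrow> h \<le> h0 \<Longrightarrow> s + \<kappa> \<le> t \<Longrightarrow> norm (U (t + h) s - U t s) \<le> e / 2" by metis
  show "\<exists>d>0. \<forall>t'\<in>{s<..}. dist t' t < d \<longrightarrow> dist (U t' s) (U t s) < e"
  proof (intro exI[of _ "min h0 \<kappa>"] conjI ballI impI)
    fix t' assume t': "t' \<in> {s<..}" "dist t' t < min h0 \<kappa>"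
    have "norm (U t' s - U t s) \<le> e / 2"
    proof (cases "t' \<le> t")
      case True
      then show ?thesis using h0(2)[of "t - t'" s t'] t' \<kappa> by (simp add: dist_real_def norm_minus_commute)
    next
      case False
      then show ?thesis using h0(2)[of "t' - t" s t] t' \<kappa> by (simp add: dist_real_def)
    qed
    then show "dist (U t' s) (U t s) < e" using e by (simp add: dist_norm)
  qed (use h0 \<kappa> in auto)
qed

section \<open>Integrated effect of a time shift on the evolution system\<close>

definition shift_diff :: "real \<Rightarrow> real \<Rightarrow> real \<Rightarrow> real" where
  "shift_diff \<tau> t s = norm (U (t + \<tau>) (t + \<tau> - s) - U t (t - s))"

lemma shift_diff_nonneg: "0 \<le> shift_diff \<tau> t s"
  by (simp add: shift_diff_def)

lemma shift_diff_decay: "0 \<le> s \<Longrightarrow> shift_diff \<tau> t s \<le> 2 * M * exp (- \<omega> * s)"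
  unfolding shift_diff_def
  using norm_triangle_ineq4[of "U (t + \<tau>) (t + \<tau> - s)" "U t (t - s)"]
    decay[of "t + \<tau> - s" "t + \<tau>"] decay[of "t - s" t] by simp

lemma shift_diff_le: "0 \<le> s \<Longrightarrow> shift_diff \<tau> t s \<le> 2 * M"
  unfolding shift_diff_def
  using norm_triangle_ineq4[of "U (t + \<tau>) (t + \<tau> - s)" "U t (t - s)"]
    norm_le[of "t + \<tau> - s" "t + \<tau>"] norm_le[of "t - s" t] by simp

lemma continuous_shift_diff: "continuous_on {0<..} (shift_diff \<tau> t)"
  unfolding shift_diff_def
  by (intro continuous_intros continuous_on_compose2[OF continuous_right]) auto

lemma integrable_shift_diff: "shift_diff \<tau> t integrable_on {0..r}"
proof (rule integrable_on_bounded_continuous_left)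
  show "continuous_on {0<..r} (shift_diff \<tau> t)"
    by (rule continuous_on_subset[OF continuous_shift_diff]) auto
  show "norm (shift_diff \<tau> t s) \<le> 2 * M" if "s \<in> {0<..r}" for s
    using shift_diff_le[of s] shift_diff_nonneg that by simp
qed

text \<open>The two time arguments are moved one after the other. A negative shift is the positive
  one seen from the base point t + \<tau>.\<close>

lemma shift_uniform:
  assumes "0 < \<epsilon>" "0 < \<kappa>"
  shows "\<exists>h0>0. \<forall>\<tau> t s. \<bar>\<tau>\<bar> \<le> h0 \<longrightarrow> \<kappa> \<le> s \<longrightarrow> shift_diff \<tau> t s \<le> \<epsilon>"
proof -
  from left_uniform[OF half_gt_zero[OF assms(1)] assms(2)] obtain h1 where h1: "0 < h1"
    "\<And>t s h. 0 \<le> h \<Longrightarrow> h \<le> h1 \<Longrightarrow> s + \<kappa> \<le> t \<Longrightarrow> norm (U (t + h) s - U t s) \<le> \<epsilon> / 2" by metis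
  from right_uniform[OF half_gt_zero[OF assms(1)] assms(2)] obtain h2 where h2: "0 < h2"
    "\<And>t s h. 0 \<le> h \<Longrightarrow> h \<le> h2 \<Longrightarrow> s + \<kappa> \<le> t \<Longrightarrow> norm (U t s - U t (s - h)) \<le> \<epsilon> / 2" by metis
  have *: "shift_diff h t s \<le> \<epsilon>" if "0 \<le> h" "h \<le> min h1 h2" "\<kappa> \<le> s" for h t s
  proof -
    have "norm (U (t + h) (t - s) - U t (t - s)) \<le> \<epsilon> / 2"
      "norm (U (t + h) (t + h - s) - U (t + h) (t - s)) \<le> \<epsilon> / 2"
      using h1(2)[of h "t - s" t] h2(2)[of h "t + h - s" "t + h"] that by (auto simp: algebra_simps)
    then show ?thesis
      unfolding shift_diff_def
      using norm_triangle_ineq[of "U (t + h) (t + h - s) - U (t + h) (t - s)" "U (t + h) (t - s) - U t (t - s)"]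
      by simp
  qed
  have "shift_diff \<tau> t s \<le> \<epsilon>" if "\<bar>\<tau>\<bar> \<le> min h1 h2" "\<kappa> \<le> s" for \<tau> t s
  proof (cases "0 \<le> \<tau>")
    case True
    then show ?thesis using * that by simp
  next
    case False
    then have "shift_diff (- \<tau>) (t + \<tau>) s \<le> \<epsilon>" using that by (intro *) auto
    then show ?thesis by (simp add: shift_diff_def norm_minus_commute)
  qed
  then show ?thesis using h1 h2 by (intro exI[of _ "min h1 h2"]) auto
qed

text \<open>The half-line integral of the hypothesis is replaced by a bound for all finite r, so
  that only integrals over compact intervals occur. The sign of \<tau> is free, since differences
  and small corrections are taken later.\<close>

definition quasi_period :: "real \<Rightarrow> real \<Rightarrow> bool" where
  "quasi_period \<epsilon> \<tau> \<longleftrightarrow> (\<exists>T. \<forall>t\<ge>T. \<forall>r\<ge>0. integral {0..r} (shift_diff \<tau> t) \<le> \<epsilon>)"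

text \<open>Both shifts are compared at the base point t - \<tau>\<open>\<^sub>2\<close>, hence the
  displaced threshold.\<close>

lemma quasi_period_diff:
  assumes "quasi_period \<epsilon>\<^sub>1 \<tau>\<^sub>1" "quasi_period \<epsilon>\<^sub>2 \<tau>\<^sub>2"
  shows "quasi_period (\<epsilon>\<^sub>1 + \<epsilon>\<^sub>2) (\<tau>\<^sub>1 - \<tau>\<^sub>2)"
proof -
  from assms obtain T\<^sub>1 T\<^sub>2 where T: "\<And>t r. T\<^sub>1 \<le> t \<Longrightarrow> 0 \<le> r \<Longrightarrow> integral {0..r} (shift_diff \<tau>\<^sub>1 t) \<le> \<epsilon>\<^sub>1"
    "\<And>t r. T\<^sub>2 \<le> t \<Longrightarrow> 0 \<le> r \<Longrightarrow> integral {0..r} (shift_diff \<tau>\<^sub>2 t) \<le> \<epsilon>\<^sub>2"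
    unfolding quasi_period_def by metis
  show ?thesis
    unfolding quasi_period_def
  proof (intro exI[of _ "max T\<^sub>1 T\<^sub>2 + \<tau>\<^sub>2"] allI impI)
    fix t r :: real assume t: "max T\<^sub>1 T\<^sub>2 + \<tau>\<^sub>2 \<le> t" and r: "0 \<le> r"
    have "integral {0..r} (shift_diff (\<tau>\<^sub>1 - \<tau>\<^sub>2) t) \<le>
        integral {0..r} (\<lambda>s. shift_diff \<tau>\<^sub>1 (t - \<tau>\<^sub>2) s + shift_diff \<tau>\<^sub>2 (t - \<tau>\<^sub>2) s)"
    proof (intro Henstock_Kurzweil_Integration.integral_le integrable_add integrable_shift_diff)
      fix s
      show "shift_diff (\<tau>\<^sub>1 - \<tau>\<^sub>2) t s \<le> shift_diff \<tau>\<^sub>1 (t - \<tau>\<^sub>2) s + shift_diff \<tau>\<^sub>2 (t - \<tau>\<^sub>2) s"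
        unfolding shift_diff_def
        using norm_triangle_ineq4[of "U (t - \<tau>\<^sub>2 + \<tau>\<^sub>1) (t - \<tau>\<^sub>2 + \<tau>\<^sub>1 - s) - U (t - \<tau>\<^sub>2) (t - \<tau>\<^sub>2 - s)"
            "U t (t - s) - U (t - \<tau>\<^sub>2) (t - \<tau>\<^sub>2 - s)"]
        by (simp add: algebra_simps)
    qed
    also have "\<dots> = integral {0..r} (shift_diff \<tau>\<^sub>1 (t - \<tau>\<^sub>2)) + integral {0..r} (shift_diff \<tau>\<^sub>2 (t - \<tau>\<^sub>2))"
      by (intro Henstock_Kurzweil_Integration.integral_add integrable_shift_diff)
    also have "\<dots> \<le> \<epsilon>\<^sub>1 + \<epsilon>\<^sub>2" using t r by (intro add_mono T) auto
    finally show "integral {0..r} (shift_diff (\<tau>\<^sub>1 - \<tau>\<^sub>2) t) \<le> \<epsilon>\<^sub>1 + \<epsilon>\<^sub>2" .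
  qed
qed

text \<open>For s \<ge> \<kappa> the geometric mean of the uniform bound \<eta> and the decay 2 M
  exp(- \<omega> s) is c exp(- \<omega> s / 2), small and integrable at once. For s < \<kappa> the
  trivial bound 2 M is dominated by 2 M exp(1 - s/\<kappa>), which avoids splitting the
  integral.\<close>

lemma quasi_period_small:
  assumes \<epsilon>: "0 < \<epsilon>"
  shows "\<exists>h0>0. \<forall>\<tau>. \<bar>\<tau>\<bar> \<le> h0 \<longrightarrow> quasi_period \<epsilon> \<tau>"
proof -
  \<comment> \<open>\<kappa> and \<open>c\<close> make each of the two exponential integrals at most
    \<epsilon>/2; \<eta> is fixed by \<eta> 2 M = \<open>c\<close> squared.\<close>
  define \<kappa> where "\<kappa> = \<epsilon> / (4 * M * exp 1)"
  define c where "c = \<omega> * \<epsilon> / 4"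
  define \<eta> where "\<eta> = c\<^sup>2 / (2 * M)"
  have *: "0 < \<kappa>" "0 < c" "0 < \<eta>" using \<epsilon> pos by (simp_all add: \<kappa>_def c_def \<eta>_def)
  from shift_uniform[OF *(3,1)] obtain h0 where h0: "0 < h0"
    "\<And>\<tau> t s. \<bar>\<tau>\<bar> \<le> h0 \<Longrightarrow> \<kappa> \<le> s \<Longrightarrow> shift_diff \<tau> t s \<le> \<eta>" by metis
  have "integral {0..r} (shift_diff \<tau> t) \<le> \<epsilon>" if \<tau>: "\<bar>\<tau>\<bar> \<le> h0" and r: "0 \<le> r" for \<tau> t r
  proof -
    let ?E = "\<lambda>a s. exp (- a * (r - s)) :: real"
    have E: "?E a integrable_on {0..r}" if "0 < a" for a
      using has_integral_exp_decay[OF that r] by blast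
    have Ei: "(\<lambda>s. 2 * M * exp 1 * ?E (1 / \<kappa>) s) integrable_on {0..r}" "(\<lambda>s. c * ?E (\<omega> / 2) s) integrable_on {0..r}"
      by (intro integrable_on_mult_right E; use * pos in simp)+
    have pw: "shift_diff \<tau> t s \<le> 2 * M * exp 1 * exp (- (1 / \<kappa>) * s) + c * exp (- (\<omega> / 2) * s)"
      if s: "0 \<le> s" for s
    proof (cases "\<kappa> \<le> s")
      case True
      define e where "e = exp (- (\<omega> / 2) * s)"
      have "exp (- \<omega> * s) = e\<^sup>2" by (simp add: e_def power2_eq_square exp_add[symmetric])
      then have "shift_diff \<tau> t s * shift_diff \<tau> t s \<le> \<eta> * (2 * M * e\<^sup>2)"
        using h0(2)[OF \<tau> True, of t] shift_diff_decay[OF s, of \<tau> t] shift_diff_nonneg * by (intro mult_mono) auto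
      also have "\<dots> = (c * e)\<^sup>2" using pos by (simp add: \<eta>_def power_mult_distrib)
      finally have "(shift_diff \<tau> t s)\<^sup>2 \<le> (c * e)\<^sup>2"
        unfolding power2_eq_square[of "shift_diff \<tau> t s"] .
      then have "shift_diff \<tau> t s \<le> c * e"
        by (rule power2_le_imp_le) (use * in \<open>simp add: e_def\<close>)
      then show ?thesis using pos by (simp add: e_def add_increasing)
    next
      case False
      have "1 \<le> exp 1 * exp (- (1 / \<kappa>) * s)"
        using False * by (simp add: exp_add[symmetric] field_simps)
      then have "2 * M * 1 \<le> 2 * M * (exp 1 * exp (- (1 / \<kappa>) * s))"
        using pos by (intro mult_left_mono) auto
      then have "shift_diff \<tau> t s \<le> 2 * M * exp 1 * exp (- (1 / \<kappa>) * s)"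
        using shift_diff_le[OF s, of \<tau> t] by simp
      then show ?thesis using * by (simp add: add_increasing2)
    qed
    have "integral {0..r} (shift_diff \<tau> t) = integral {0..r} (\<lambda>s. shift_diff \<tau> t (r - s))"
      by (simp add: integral_reflect_Icc_0)
    also have "\<dots> \<le> integral {0..r} (\<lambda>s. 2 * M * exp 1 * ?E (1 / \<kappa>) s + c * ?E (\<omega> / 2) s)"
    proof (rule Henstock_Kurzweil_Integration.integral_le)
      show "(\<lambda>s. shift_diff \<tau> t (r - s)) integrable_on {0..r}"
      proof (rule integrable_on_bounded_continuous_right)
        show "continuous_on {0..<r} (\<lambda>s. shift_diff \<tau> t (r - s))"
          by (intro continuous_on_compose2[OF continuous_shift_diff]) (auto intro!: continuous_intros)
        show "norm (shift_diff \<tau> t (r - s)) \<le> 2 * M" if "s \<in> {0..<r}" for s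
          using shift_diff_le[of "r - s"] shift_diff_nonneg that by simp
      qed
      show "shift_diff \<tau> t (r - s) \<le> 2 * M * exp 1 * ?E (1 / \<kappa>) s + c * ?E (\<omega> / 2) s" if "s \<in> {0..r}" for s
        using pw[of "r - s"] that by simp
    qed (intro integrable_add Ei)
    also have "\<dots> = 2 * M * exp 1 * integral {0..r} (?E (1 / \<kappa>)) + c * integral {0..r} (?E (\<omega> / 2))"
      unfolding Henstock_Kurzweil_Integration.integral_add[OF Ei] by simp
    also have "\<dots> \<le> 2 * M * exp 1 * (1 / (1 / \<kappa>)) + c * (1 / (\<omega> / 2))"
      using r * pos by (intro add_mono mult_left_mono integral_exp_decay) auto
    also have "\<dots> = \<epsilon>" using pos \<epsilon> by (simp add: \<kappa>_def c_def)
    finally show ?thesis .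
  qed
  then show ?thesis unfolding quasi_period_def using h0(1) by blast
qed


section \<open>Variation of constants integrals\<close>

definition conv :: "real \<Rightarrow> real \<Rightarrow> (real \<Rightarrow> 'a) \<Rightarrow> 'a" where
  "conv a t g = integral {a..t} (\<lambda>s. U t s (g s))"

text \<open>The integrand need not be continuous at \<open>s = t\<close>, since \<open>D(A(t))\<close> need not be dense.\<close>

lemma conv_integrable:
  assumes g: "continuous_on {a..t} g"
  shows "(\<lambda>s. U t s (g s)) integrable_on {a..t}"
proof -
  have "bounded (g ` {a..t})"
    using g by (intro compact_imp_bounded compact_continuous_image) auto
  then obtain b where b: "\<forall>s\<in>{a..t}. norm (g s) \<le> b"
    by (auto simp: bounded_iff)
  show ?thesis
  proof (rule integrable_on_bounded_continuous_right)
    show "continuous_on {a..<t} (\<lambda>s. U t s (g s))"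
      by (intro blinfun.continuous_on continuous_on_subset[OF continuous_right] continuous_on_subset[OF g]) auto
    show "norm (U t s (g s)) \<le> M * b" if "s \<in> {a..<t}" for s
      using b that by (intro apply_le') auto
  qed
qed

lemma conv_le:
  assumes g: "continuous_on {a..t} g" "\<And>s. s \<in> {a..t} \<Longrightarrow> norm (g s) \<le> G" and "a \<le> t"
  shows "norm (conv a t g) \<le> M * G / \<omega>"
proof -
  have G: "0 \<le> G" using g(2)[of a] assms(3) by (auto intro: order_trans[OF norm_ge_zero])
  have "norm (conv a t g) \<le> integral {a..t} (\<lambda>s. M * G * exp (- \<omega> * (t - s)))"
    unfolding conv_def
  proof (rule Henstock_Kurzweil_Integration.integral_norm_bound_integral)
    show "(\<lambda>s. U t s (g s)) integrable_on {a..t}" using g(1) by (rule conv_integrable)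
    show "(\<lambda>s. M * G * exp (- \<omega> * (t - s))) integrable_on {a..t}"
      using has_integral_exp_decay[OF pos(2) assms(3)] by (intro integrable_on_mult_right) blast
    show "norm (U t s (g s)) \<le> M * G * exp (- \<omega> * (t - s))" if "s \<in> {a..t}" for s
    proof -
      have "norm (U t s (g s)) \<le> M * exp (- \<omega> * (t - s)) * norm (g s)"
        using that by (intro apply_decay) auto
      also have "\<dots> \<le> M * exp (- \<omega> * (t - s)) * G"
        using pos g(2)[OF that] by (intro mult_left_mono) auto
      finally show ?thesis by (simp add: mult_ac)
    qed
  qed
  also have "\<dots> = M * G * integral {a..t} (\<lambda>s. exp (- \<omega> * (t - s)))" by simp
  also have "\<dots> \<le> M * G * (1 / \<omega>)"
    using G pos assms(3) by (intro mult_left_mono integral_exp_decay) auto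
  finally show ?thesis by simp
qed

lemma conv_le_length:
  assumes g: "continuous_on {a..t} g" "\<And>s. s \<in> {a..t} \<Longrightarrow> norm (g s) \<le> G" and "a \<le> t"
  shows "norm (conv a t g) \<le> M * G * (t - a)"
proof -
  have "norm (conv a t g) \<le> integral {a..t} (\<lambda>s. M * G)"
    unfolding conv_def
  proof (rule Henstock_Kurzweil_Integration.integral_norm_bound_integral)
    show "(\<lambda>s. U t s (g s)) integrable_on {a..t}" using g(1) by (rule conv_integrable)
    show "norm (U t s (g s)) \<le> M * G" if "s \<in> {a..t}" for s
      using g(2)[OF that] that by (intro apply_le') auto
  qed auto
  then show ?thesis using assms(3) by (simp add: mult_ac)
qed

lemma conv_split:
  assumes g: "continuous_on {a..t} g" and c: "a \<le> c" "c \<le> t"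
  shows "conv a t g = U t c (conv a c g) + conv c t g"
proof -
  have "conv a t g = integral {a..c} (\<lambda>s. U t s (g s)) + conv c t g"
    unfolding conv_def
    using Henstock_Kurzweil_Integration.integral_combine[OF c conv_integrable[OF g]] by simp
  also have "integral {a..c} (\<lambda>s. U t s (g s)) = integral {a..c} (\<lambda>s. U t c (U c s (g s)))"
    by (intro integral_cong) (subst U_trans[OF _ c(2)], auto)
  also have "\<dots> = U t c (conv a c g)"
  proof -
    have "continuous_on {a..c} g" using g by (rule continuous_on_subset) (use c in auto)
    from integral_linear[OF conv_integrable[OF this] blinfun.bounded_linear_right[of "U t c"]]
    show ?thesis by (simp add: conv_def o_def)
  qed
  finally show ?thesis .
qed

lemma continuous_conv:
  assumes g: "continuous_on {0..} g" "\<And>s. 0 \<le> s \<Longrightarrow> norm (g s) \<le> G"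
  shows "continuous_on {0..} (\<lambda>t. conv 0 t g)"
proof -
  have G: "0 \<le> G" using g(2)[of 0] by (auto intro: order_trans[OF norm_ge_zero])
  have gc: "continuous_on {a..b} g" if "0 \<le> a" for a b
    using g(1) by (rule continuous_on_subset) (use that in auto)
  have key: "\<exists>h0>0. \<forall>t\<ge>0. \<forall>h\<in>{0..h0}. norm (conv 0 (t + h) g - conv 0 t g) \<le> \<epsilon>" if \<epsilon>: "0 < \<epsilon>" for \<epsilon>
  proof -
    \<comment> \<open>The short stretches have total length at most 3 \<kappa> and contribute at
      most \<epsilon>/2; G + 1 avoids division by zero.\<close>
    define \<kappa> where "\<kappa> = \<epsilon> / (6 * M * (G + 1))"
    define d where "d = M * G / \<omega> + 1"
    define \<eta> where "\<eta> = \<epsilon> / (2 * d)"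
    have pos': "0 < G + 1" "0 < d" using G pos by (auto simp: d_def intro: add_nonneg_pos)
    have \<kappa>: "0 < \<kappa>" "0 < \<eta>" using \<epsilon> pos pos' by (auto simp: \<kappa>_def \<eta>_def)
    have "M * G * (3 * \<kappa>) = \<epsilon> / 2 * (G / (G + 1))" using pos pos' by (simp add: \<kappa>_def)
    also have "\<dots> \<le> \<epsilon> / 2 * 1" using pos' \<epsilon> by (intro mult_left_mono) auto
    finally have \<kappa>3: "M * G * (3 * \<kappa>) \<le> \<epsilon> / 2" by simp
    have "\<eta> * (M * G / \<omega>) \<le> \<eta> * d" unfolding d_def using \<kappa> by (intro mult_left_mono) auto
    also have "\<dots> = \<epsilon> / 2" using pos' by (simp add: \<eta>_def)
    finally have \<eta>2: "\<eta> * (M * G / \<omega>) \<le> \<epsilon> / 2" .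
    from left_uniform[OF \<kappa>(2,1)] obtain h0 where h0: "0 < h0"
      "\<And>t s h. 0 \<le> h \<Longrightarrow> h \<le> h0 \<Longrightarrow> s + \<kappa> \<le> t \<Longrightarrow> norm (U (t + h) s - U t s) \<le> \<eta>" by metis
    have "norm (conv 0 (t + h) g - conv 0 t g) \<le> \<epsilon>" if t: "0 \<le> t" and h: "h \<in> {0..min h0 \<kappa>}" for t h
    proof (cases "t \<le> \<kappa>")
      case True
      have "norm (conv 0 (t + h) g - conv 0 t g) \<le> norm (conv 0 (t + h) g) + norm (conv 0 t g)"
        by (rule norm_triangle_ineq4)
      also have "\<dots> \<le> M * G * (t + h - 0) + M * G * (t - 0)"
        using t h g(2) by (intro add_mono conv_le_length gc) auto
      also have "\<dots> = M * G * (2 * t + h)" by (simp add: algebra_simps)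
      also have "\<dots> \<le> M * G * (3 * \<kappa>)" using True h G pos by (intro mult_left_mono) auto
      finally show ?thesis using \<kappa>3 \<epsilon> by simp
    next
      case False
      define c where "c = t - \<kappa>"
      have c: "0 \<le> c" "c \<le> t" "c \<le> t + h" "c + \<kappa> \<le> t" using False \<kappa> h by (auto simp: c_def)
      have "conv 0 (t + h) g - conv 0 t g = (U (t + h) c - U t c) (conv 0 c g) + (conv c (t + h) g - conv c t g)"
        using conv_split[OF gc, of 0 c "t + h"] conv_split[OF gc, of 0 c t] c
        by (simp add: blinfun.diff_left)
      also have "norm \<dots> \<le> norm ((U (t + h) c - U t c) (conv 0 c g)) + (norm (conv c (t + h) g) + norm (conv c t g))"
        by (intro order_trans[OF norm_triangle_ineq] add_left_mono norm_triangle_ineq4)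
      also have "\<dots> \<le> \<eta> * (M * G / \<omega>) + (M * G * (t + h - c) + M * G * (t - c))"
      proof (intro add_mono conv_le_length gc)
        have "norm ((U (t + h) c - U t c) (conv 0 c g)) \<le> norm (U (t + h) c - U t c) * norm (conv 0 c g)"
          by (rule norm_blinfun)
        also have "\<dots> \<le> \<eta> * (M * G / \<omega>)"
          using h0(2)[of h c t] conv_le[OF gc, of 0 c G] g(2) c h \<kappa> by (intro mult_mono) auto
        finally show "norm ((U (t + h) c - U t c) (conv 0 c g)) \<le> \<eta> * (M * G / \<omega>)" .
      qed (use c g(2) in auto)
      also have "M * G * (t + h - c) + M * G * (t - c) = M * G * (2 * \<kappa> + h)" by (simp add: c_def algebra_simps)
      also have "\<dots> \<le> M * G * (3 * \<kappa>)" using h G pos by (intro mult_left_mono) auto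
      finally show ?thesis using \<kappa>3 \<eta>2 by linarith
    qed
    then show ?thesis using h0(1) \<kappa> by (intro exI[of _ "min h0 \<kappa>"]) auto
  qed
  show ?thesis
    unfolding continuous_on_iff
  proof (intro ballI allI impI)
    fix t e :: real assume t: "t \<in> {0..}" and e: "0 < e"
    from key[OF half_gt_zero[OF e]] obtain h0 where h0: "0 < h0"
      "\<And>t h. 0 \<le> t \<Longrightarrow> h \<in> {0..h0} \<Longrightarrow> norm (conv 0 (t + h) g - conv 0 t g) \<le> e / 2" by metis
    have "dist (conv 0 t' g) (conv 0 t g) < e" if t': "0 \<le> t'" "dist t' t < h0" for t'
    proof -
      have "norm (conv 0 t' g - conv 0 t g) \<le> e / 2"
      proof (cases "t' \<le> t")
        case True
        then show ?thesis using h0(2)[of t' "t - t'"] t' by (simp add: dist_real_def norm_minus_commute)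
      next
        case False
        then show ?thesis using h0(2)[of t "t' - t"] t t' by (simp add: dist_real_def)
      qed
      then show ?thesis using e by (simp add: dist_norm)
    qed
    then show "\<exists>d>0. \<forall>t'\<in>{0..}. dist t' t < d \<longrightarrow> dist (conv 0 t' g) (conv 0 t g) < e"
      using h0(1) by auto
  qed
qed

end

section \<open>Mild solutions\<close>

locale semilinear_evolution = stable_evolution U M \<omega>
  for U :: "real \<Rightarrow> real \<Rightarrow> 'a::banach \<Rightarrow>\<^sub>L 'a" and M \<omega> :: real +
  fixes F :: "real \<Rightarrow> 'a \<Rightarrow> 'a" and x :: 'a and L :: real
  assumes initial: "((\<lambda>t. U t 0 x) \<longlongrightarrow> x) (at_right 0)"
    and F_cont: "continuous_on ({0..} \<times> UNIV) (\<lambda>(t, x). F t x)"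
    and F_bounded: "bounded ((\<lambda>t. F t 0) ` {0..})"
    and L: "0 < L" "L < \<omega> / M"
    and Lipschitz: "0 \<le> t \<Longrightarrow> norm (F t y - F t z) \<le> L * norm (y - z)"
begin

text \<open>Contraction constant of the solution map: M/\<omega> bounds convolution with U in the
  supremum norm, L the change of the source.\<close>

definition q where "q = M * L / \<omega>"

lemma q: "0 < q" "q < 1"
  using L pos by (auto simp: q_def field_simps)

lemma continuous_orbit: "continuous_on {0..} (\<lambda>t. U t 0 x)"
  unfolding continuous_on_eq_continuous_within
proof
  fix t :: real assume t: "t \<in> {0..}"
  show "continuous (at t within {0..}) (\<lambda>t. U t 0 x)"
  proof (cases "t = 0")
    case True
    then show ?thesis using initial by (simp add: continuous_within at_within_Ici_at_right U_refl)
  next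
    case False
    then have "isCont (\<lambda>t. U t 0) t"
      using continuous_left[of 0] t by (simp add: continuous_on_eq_continuous_at)
    then have "isCont (\<lambda>t. U t 0 x) t" by (intro blinfun.continuous) auto
    then show ?thesis by (rule continuous_at_imp_continuous_at_within)
  qed
qed

lemma F_comp_continuous:
  assumes "continuous_on {0..} u"
  shows "continuous_on {0..} (\<lambda>s. F s (u s))"
  using continuous_on_compose2[OF F_cont continuous_on_Pair[OF continuous_on_id assms]] by auto

lemma F_comp_bounded:
  assumes "bounded (u ` {0..})"
  obtains G where "\<And>s. 0 \<le> s \<Longrightarrow> norm (F s (u s)) \<le> G"
proof -
  obtain a where a: "\<forall>s\<in>{0..}. norm (u s) \<le> a" using assms by (auto simp: bounded_iff)
  obtain b where b: "\<forall>s\<in>{0..}. norm (F s 0) \<le> b" using F_bounded by (auto simp: bounded_iff)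
  have "norm (F s (u s)) \<le> b + L * a" if s: "0 \<le> s" for s
  proof -
    have "norm (F s (u s)) \<le> norm (F s 0) + norm (F s (u s) - F s 0)"
      by (metis add.commute diff_add_cancel norm_triangle_ineq)
    also have "\<dots> \<le> b + L * norm (u s)" using b s Lipschitz[OF s, of "u s" 0] by (intro add_mono) auto
    also have "\<dots> \<le> b + L * a" using a s L by (intro add_left_mono mult_left_mono) auto
    finally show ?thesis .
  qed
  then show ?thesis by (rule that)
qed

section \<open>Existence and uniqueness of bounded mild solutions\<close>

definition mild :: "(real \<Rightarrow> 'a) \<Rightarrow> bool" where
  "mild u \<longleftrightarrow> continuous_on {0..} u \<and> bounded (u ` {0..}) \<and>
     (\<forall>t\<ge>0. u t = U t 0 x + conv 0 t (\<lambda>s. F s (u s)))"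

text \<open>Constant extension to negative times, so that the map acts on bounded continuous
  functions on the whole line.\<close>

definition picard :: "(real \<Rightarrow> 'a) \<Rightarrow> real \<Rightarrow> 'a" where
  "picard u t = U (max 0 t) 0 x + conv 0 (max 0 t) (\<lambda>s. F s (u s))"

lemma picard_bcontfun:
  assumes u: "continuous_on {0..} u" "bounded (u ` {0..})"
  shows "picard u \<in> bcontfun"
proof -
  obtain G where G: "\<And>s. 0 \<le> s \<Longrightarrow> norm (F s (u s)) \<le> G" by (rule F_comp_bounded[OF u(2)]) blast
  have g: "continuous_on {0..} (\<lambda>s. F s (u s))" by (rule F_comp_continuous[OF u(1)])
  have gc: "continuous_on {0..t} (\<lambda>s. F s (u s))" for t
    using g by (rule continuous_on_subset) auto
  show ?thesis
  proof (rule bcontfun_normI)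
    have max: "continuous_on UNIV (\<lambda>t. max 0 t :: real)" by (intro continuous_intros)
    show "continuous_on UNIV (picard u)"
      unfolding picard_def
      by (intro continuous_on_add continuous_on_compose2[OF continuous_orbit max]
          continuous_on_compose2[OF continuous_conv[OF g G] max]) auto
    show "norm (picard u t) \<le> M * norm x + M * G / \<omega>" for t
      unfolding picard_def
      by (intro order_trans[OF norm_triangle_ineq] add_mono apply_le conv_le gc G) auto
  qed
qed

lemma picard_diff:
  assumes u: "continuous_on {0..} u" and v: "continuous_on {0..} v"
    and d: "\<And>s. 0 \<le> s \<Longrightarrow> norm (u s - v s) \<le> d"
  shows "norm (picard u t - picard v t) \<le> q * d"
proof -
  let ?t = "max 0 t"
  have gc: "continuous_on {0..?t} (\<lambda>s. F s (w s))" if "continuous_on {0..} w" for w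
    using F_comp_continuous[OF that] by (rule continuous_on_subset) auto
  have "picard u t - picard v t = conv 0 ?t (\<lambda>s. F s (u s)) - conv 0 ?t (\<lambda>s. F s (v s))"
    by (simp add: picard_def)
  also have "\<dots> = conv 0 ?t (\<lambda>s. F s (u s) - F s (v s))"
    unfolding conv_def blinfun.diff_right
    using conv_integrable[OF gc[OF u]] conv_integrable[OF gc[OF v]]
    by (rule Henstock_Kurzweil_Integration.integral_diff[symmetric])
  also have "norm \<dots> \<le> M * (L * d) / \<omega>"
  proof (rule conv_le)
    show "norm (F s (u s) - F s (v s)) \<le> L * d" if "s \<in> {0..?t}" for s
      using Lipschitz[of s "u s" "v s"] d[of s] L that
      by (intro order_trans[OF Lipschitz] mult_left_mono) auto
  qed (auto intro!: continuous_intros gc u v)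
  finally show ?thesis by (simp add: q_def)
qed

lemma mild_eq_picard: "mild u \<Longrightarrow> 0 \<le> t \<Longrightarrow> u t = picard u t"
  by (simp add: mild_def picard_def)

text \<open>\<open>mild\<close> constrains nonnegative times only, so u and v need not be bounded
  continuous functions on the whole line. The contraction estimate is therefore iterated by hand on
  the half line.\<close>

lemma mild_unique:
  assumes u: "mild u" and v: "mild v" and t: "0 \<le> t"
  shows "u t = v t"
proof -
  have "bounded ((\<lambda>t. u t - v t) ` {0..})"
    using u v by (intro bounded_minus_comp) (auto simp: mild_def)
  then obtain b where b: "\<And>t. 0 \<le> t \<Longrightarrow> norm (u t - v t) \<le> b"
    by (auto simp: bounded_iff)
  have le: "norm (u t - v t) \<le> q ^ n * b" if "0 \<le> t" for t n
    using that
  proof (induction n arbitrary: t)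
    case 0
    then show ?case using b by simp
  next
    case (Suc n)
    have "norm (picard u t - picard v t) \<le> q * (q ^ n * b)"
      using u v Suc by (intro picard_diff) (auto simp: mild_def)
    then show ?case using mild_eq_picard[OF u Suc.prems] mild_eq_picard[OF v Suc.prems] by simp
  qed
  have "(\<lambda>n. q ^ n * b) \<longlonglongrightarrow> 0"
    using q by (intro tendsto_mult_left_zero LIMSEQ_power_zero) auto
  then have "norm (u t - v t) \<le> 0"
    by (rule tendsto_lowerbound) (use le[OF t] in auto)
  then show ?thesis by simp
qed

lemma mild_exists: "\<exists>u. mild u"
proof -
  define \<Phi> where "\<Phi> u = Bcontfun (picard (apply_bcontfun u))" for u :: "real \<Rightarrow>\<^sub>C 'a"
  have bnd: "bounded (apply_bcontfun u ` {0..})" for u :: "real \<Rightarrow>\<^sub>C 'a"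
    by (rule bounded_subset[OF bounded_apply_bcontfun]) auto
  have \<Phi>: "apply_bcontfun (\<Phi> u) = picard (apply_bcontfun u)" for u
    unfolding \<Phi>_def by (intro Bcontfun_inverse picard_bcontfun bnd) auto
  have "\<exists>!u. \<Phi> u = u"
  proof (rule banach_fix_type)
    show "\<forall>u v. dist (\<Phi> u) (\<Phi> v) \<le> q * dist u v"
    proof (intro allI dist_bound)
      fix u v t
      show "dist (\<Phi> u t) (\<Phi> v t) \<le> q * dist u v"
        unfolding \<Phi> dist_norm[of "picard _ _"]
        by (intro picard_diff) (auto simp: dist_norm[symmetric] dist_bounded)
    qed
  qed (use q in auto)
  then obtain u where "\<Phi> u = u" by blast
  then have u: "apply_bcontfun u t = picard (apply_bcontfun u) t" for t by (metis \<Phi>)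
  have "u t = U t 0 x + conv 0 t (\<lambda>s. F s (u s))" if "0 \<le> t" for t
    by (subst u) (simp add: picard_def that)
  then have "mild (apply_bcontfun u)" unfolding mild_def by (intro conjI allI impI bnd) auto
  then show ?thesis by blast
qed

section \<open>Quasi-periods of the nonlinearity and of the solution\<close>

text \<open>Uniform in all y: in \<open>QAAP2\<close> the threshold is chosen before the bounded
  set.\<close>

definition F_period :: "real \<Rightarrow> real \<Rightarrow> bool" where
  "F_period \<epsilon> \<tau> \<longleftrightarrow> (\<exists>T. \<forall>t\<ge>T. \<forall>y. norm (F (t + \<tau>) y - F t y) \<le> \<epsilon>)"

lemma F_period_diff:
  assumes "F_period \<epsilon>\<^sub>1 \<tau>\<^sub>1" "F_period \<epsilon>\<^sub>2 \<tau>\<^sub>2"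
  shows "F_period (\<epsilon>\<^sub>1 + \<epsilon>\<^sub>2) (\<tau>\<^sub>1 - \<tau>\<^sub>2)"
proof -
  from assms obtain T\<^sub>1 T\<^sub>2 where T: "\<And>t y. T\<^sub>1 \<le> t \<Longrightarrow> norm (F (t + \<tau>\<^sub>1) y - F t y) \<le> \<epsilon>\<^sub>1"
    "\<And>t y. T\<^sub>2 \<le> t \<Longrightarrow> norm (F (t + \<tau>\<^sub>2) y - F t y) \<le> \<epsilon>\<^sub>2"
    unfolding F_period_def by metis
  show ?thesis
    unfolding F_period_def
  proof (intro exI[of _ "max T\<^sub>1 T\<^sub>2 + \<tau>\<^sub>2"] allI impI)
    fix t y assume t: "max T\<^sub>1 T\<^sub>2 + \<tau>\<^sub>2 \<le> t"
    have "norm (F (t - \<tau>\<^sub>2 + \<tau>\<^sub>1) y - F (t - \<tau>\<^sub>2) y) \<le> \<epsilon>\<^sub>1" "norm (F t y - F (t - \<tau>\<^sub>2) y) \<le> \<epsilon>\<^sub>2"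
      using T(1)[of "t - \<tau>\<^sub>2" y] T(2)[of "t - \<tau>\<^sub>2" y] t by auto
    moreover have eq: "F (t + (\<tau>\<^sub>1 - \<tau>\<^sub>2)) y - F t y = (F (t - \<tau>\<^sub>2 + \<tau>\<^sub>1) y - F (t - \<tau>\<^sub>2) y) - (F t y - F (t - \<tau>\<^sub>2) y)"
      by (simp add: algebra_simps)
    ultimately show "norm (F (t + (\<tau>\<^sub>1 - \<tau>\<^sub>2)) y - F t y) \<le> \<epsilon>\<^sub>1 + \<epsilon>\<^sub>2"
      unfolding eq using norm_triangle_ineq4[of "F (t - \<tau>\<^sub>2 + \<tau>\<^sub>1) y - F (t - \<tau>\<^sub>2) y" "F t y - F (t - \<tau>\<^sub>2) y"] by linarith
  qed
qed

lemma F_period_mono: "F_period \<epsilon> \<tau> \<Longrightarrow> \<epsilon> \<le> \<epsilon>' \<Longrightarrow> F_period \<epsilon>' \<tau>"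
  unfolding F_period_def by (meson order.trans)

text \<open>After the substitution s to s + \<tau> the difference has three parts: the history on
  [0, \<tau>], which the evolution forgets; the change of the kernel; and the change of the
  source.\<close>

lemma shifted_difference:
  assumes g: "continuous_on {0..} g" "\<And>s. 0 \<le> s \<Longrightarrow> norm (g s) \<le> G" and \<tau>: "0 \<le> \<tau>" and t: "0 \<le> t"
  shows "norm (conv 0 (t + \<tau>) g - conv 0 t g) \<le>
    norm (U (t + \<tau>) \<tau> (conv 0 \<tau> g)) + G * integral {0..t} (shift_diff \<tau> t) + norm (conv 0 t (\<lambda>s. g (s + \<tau>) - g s))"
proof -
  have gc: "continuous_on {a..b} g" if "0 \<le> a" for a b
    using g(1) by (rule continuous_on_subset) (use that in auto)
  have g\<tau>: "continuous_on {0..t} (\<lambda>s. g (s + \<tau>))"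
    by (rule continuous_on_compose2[OF g(1)]) (use \<tau> in \<open>auto intro!: continuous_intros\<close>)
  have shift: "((\<lambda>s. U (t + \<tau>) (s + \<tau>) (g (s + \<tau>))) has_integral conv \<tau> (t + \<tau>) g) {0..t}"
  proof -
    have "((\<lambda>s. U (t + \<tau>) s (g s)) has_integral conv \<tau> (t + \<tau>) g) {0 + \<tau>..t + \<tau>}"
      unfolding conv_def add_0 by (intro integrable_integral conv_integrable gc \<tau>)
    then show ?thesis
      unfolding has_integral_shift_Icc_real[symmetric] by (simp add: o_def add.commute)
  qed
  have 1: "((\<lambda>s. U t s (g (s + \<tau>))) has_integral conv 0 t (\<lambda>s. g (s + \<tau>))) {0..t}"
    unfolding conv_def by (intro integrable_integral conv_integrable g\<tau>)
  have 2: "((\<lambda>s. U t s (g s)) has_integral conv 0 t g) {0..t}"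
    unfolding conv_def by (intro integrable_integral conv_integrable gc) simp
  have "((\<lambda>s. U t s (g (s + \<tau>) - g s)) has_integral conv 0 t (\<lambda>s. g (s + \<tau>)) - conv 0 t g) {0..t}"
    using has_integral_diff[OF 1 2] by (simp add: blinfun.diff_right)
  then have c2: "conv 0 t (\<lambda>s. g (s + \<tau>) - g s) = conv 0 t (\<lambda>s. g (s + \<tau>)) - conv 0 t g"
    unfolding conv_def[of _ _ "\<lambda>s. g (s + \<tau>) - g s"] by (rule integral_unique)
  have d: "((\<lambda>s. (U (t + \<tau>) (s + \<tau>) - U t s) (g (s + \<tau>))) has_integral
      conv \<tau> (t + \<tau>) g - conv 0 t (\<lambda>s. g (s + \<tau>))) {0..t}"
    using has_integral_diff[OF shift 1] by (simp add: blinfun.diff_left)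
  have "norm (conv \<tau> (t + \<tau>) g - conv 0 t (\<lambda>s. g (s + \<tau>))) \<le> integral {0..t} (\<lambda>s. G * shift_diff \<tau> t (t - s))"
    unfolding integral_unique[OF d, symmetric]
  proof (rule Henstock_Kurzweil_Integration.integral_norm_bound_integral)
    show "(\<lambda>s. (U (t + \<tau>) (s + \<tau>) - U t s) (g (s + \<tau>))) integrable_on {0..t}" using d by blast
    show "(\<lambda>s. G * shift_diff \<tau> t (t - s)) integrable_on {0..t}"
    proof (intro integrable_on_mult_right integrable_on_bounded_continuous_right)
      show "continuous_on {0..<t} (\<lambda>s. shift_diff \<tau> t (t - s))"
        by (intro continuous_on_compose2[OF continuous_shift_diff]) (auto intro!: continuous_intros)
      show "norm (shift_diff \<tau> t (t - s)) \<le> 2 * M" if "s \<in> {0..<t}" for s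
        using shift_diff_le[of "t - s"] shift_diff_nonneg that by simp
    qed
    show "norm ((U (t + \<tau>) (s + \<tau>) - U t s) (g (s + \<tau>))) \<le> G * shift_diff \<tau> t (t - s)" if "s \<in> {0..t}" for s
    proof -
      have "norm ((U (t + \<tau>) (s + \<tau>) - U t s) (g (s + \<tau>))) \<le> shift_diff \<tau> t (t - s) * norm (g (s + \<tau>))"
        using norm_blinfun[of "U (t + \<tau>) (s + \<tau>) - U t s" "g (s + \<tau>)"] by (simp add: shift_diff_def algebra_simps)
      also have "\<dots> \<le> shift_diff \<tau> t (t - s) * G"
        using g(2)[of "s + \<tau>"] that \<tau> shift_diff_nonneg by (intro mult_left_mono) auto
      finally show ?thesis by (simp add: mult.commute)
    qed
  qed
  also have "\<dots> = G * integral {0..t} (shift_diff \<tau> t)" by (simp add: integral_reflect_Icc_0)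
  finally have dd: "norm (conv \<tau> (t + \<tau>) g - conv 0 t (\<lambda>s. g (s + \<tau>))) \<le> G * integral {0..t} (shift_diff \<tau> t)" .
  have eq: "conv 0 (t + \<tau>) g - conv 0 t g = U (t + \<tau>) \<tau> (conv 0 \<tau> g)
      + (conv \<tau> (t + \<tau>) g - conv 0 t (\<lambda>s. g (s + \<tau>))) + conv 0 t (\<lambda>s. g (s + \<tau>) - g s)"
    using conv_split[OF gc, of 0 \<tau> "t + \<tau>"] \<tau> t by (simp add: c2)
  show ?thesis
    unfolding eq using dd norm_triangle_ineq[of "U (t + \<tau>) \<tau> (conv 0 \<tau> g)" "conv \<tau> (t + \<tau>) g - conv 0 t (\<lambda>s. g (s + \<tau>))"]
      norm_triangle_ineq[of "U (t + \<tau>) \<tau> (conv 0 \<tau> g) + (conv \<tau> (t + \<tau>) g - conv 0 t (\<lambda>s. g (s + \<tau>)))" "conv 0 t (\<lambda>s. g (s + \<tau>) - g s)"]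
    by linarith
qed

lemma exp_decay_eventually:
  assumes "0 < \<epsilon>"
  shows "eventually (\<lambda>t. c * exp (- \<omega> * (t - s)) \<le> \<epsilon>) at_top"
proof -
  have "filterlim (\<lambda>t. \<omega> * (- s + t)) at_top at_top"
    by (intro filterlim_tendsto_pos_mult_at_top[OF tendsto_const pos(2)]
        filterlim_tendsto_add_at_top[OF tendsto_const] filterlim_ident)
  then have "filterlim (\<lambda>t. \<omega> * (t - s)) at_top at_top" by (simp add: algebra_simps)
  then have "((\<lambda>t. c * exp (- (\<omega> * (t - s)))) \<longlongrightarrow> 0) at_top"
    by (intro tendsto_mult_right_zero filterlim_compose[OF exp_at_bot] filterlim_compose[OF filterlim_uminus_at_bot_at_top])
  from order_tendstoD(2)[OF this assms] show ?thesis by (rule eventually_mono) simp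
qed

text \<open>The source changes by at most \<epsilon> + L b at late times if u(t + \<tau>) - u(t) is
  eventually bounded by b. Hence an eventual bound b improves to e + q b, and e / (1 - q) is the
  fixed point of this recursion.\<close>

lemma mild_quasi_period:
  assumes u: "mild u" and R: "\<And>t. 0 \<le> t \<Longrightarrow> norm (u t) \<le> R"
    and G: "\<And>t. 0 \<le> t \<Longrightarrow> norm (F t (u t)) \<le> G"
    and \<epsilon>: "0 < \<epsilon>" and \<tau>: "0 \<le> \<tau>" and periods: "quasi_period \<epsilon> \<tau>" "F_period \<epsilon> \<tau>"
  shows "eventually (\<lambda>t. norm (u (t + \<tau>) - u t) \<le> ((G + 4 + M / \<omega>) / (1 - q) + 1) * \<epsilon>) at_top"
proof -
  define g where "g s = F s (u s)" for s
  define \<Delta> where "\<Delta> s = g (s + \<tau>) - g s" for s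
  \<comment> \<open>G stems from the change of kernel, M/\<omega> from the change of F, and 4 counts
    the decaying terms: two orbits of x, the history up to \<tau>, and the source difference before
    c.\<close>
  define e where "e = (G + 4 + M / \<omega>) * \<epsilon>"
  have u': "continuous_on {0..} u" "\<And>t. 0 \<le> t \<Longrightarrow> u t = U t 0 x + conv 0 t g"
    using u unfolding mild_def g_def by blast+
  have R0: "0 \<le> R" using R[of 0] by (auto intro: order_trans[OF norm_ge_zero])
  have G0: "0 \<le> G" using G[of 0] by (auto intro: order_trans[OF norm_ge_zero])
  have g: "continuous_on {0..} g" "\<And>s. 0 \<le> s \<Longrightarrow> norm (g s) \<le> G"
    unfolding g_def using F_comp_continuous[OF u'(1)] G by auto
  have \<Delta>c: "continuous_on {a..b} \<Delta>" if "0 \<le> a" for a b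
    unfolding \<Delta>_def
    by (intro continuous_intros continuous_on_subset[OF g(1)] continuous_on_compose2[OF g(1)])
      (use that \<tau> in auto)
  have \<Delta>: "norm (\<Delta> s) \<le> 2 * G" if "0 \<le> s" for s
    unfolding \<Delta>_def using norm_triangle_ineq4[of "g (s + \<tau>)" "g s"] g(2)[of s] g(2)[of "s + \<tau>"] that \<tau> by simp
  from periods obtain T where T: "\<And>t r. T \<le> t \<Longrightarrow> 0 \<le> r \<Longrightarrow> integral {0..r} (shift_diff \<tau> t) \<le> \<epsilon>"
    unfolding quasi_period_def by metis
  from periods obtain S where S: "\<And>t y. S \<le> t \<Longrightarrow> norm (F (t + \<tau>) y - F t y) \<le> \<epsilon>"
    unfolding F_period_def by metis
  have step: "eventually (\<lambda>t. norm (u (t + \<tau>) - u t) \<le> e + q * b) at_top"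
    if b: "0 \<le> b" and ev: "eventually (\<lambda>t. norm (u (t + \<tau>) - u t) \<le> b) at_top" for b
  proof -
    from ev obtain B where B: "\<And>t. B \<le> t \<Longrightarrow> norm (u (t + \<tau>) - u t) \<le> b"
      unfolding eventually_at_top_linorder by metis
    \<comment> \<open>Beyond c both the quasi-period estimate for F and the current bound b are in
      force; the contribution from before c decays as t grows.\<close>
    define c where "c = max 0 (max S B)"
    have c: "0 \<le> c" "S \<le> c" "B \<le> c" by (auto simp: c_def)
    have \<Delta>2: "norm (\<Delta> s) \<le> \<epsilon> + L * b" if "c \<le> s" for s
    proof -
      have "\<Delta> s = (F (s + \<tau>) (u (s + \<tau>)) - F s (u (s + \<tau>))) + (F s (u (s + \<tau>)) - F s (u s))"
        by (simp add: \<Delta>_def g_def)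
      also have "norm \<dots> \<le> \<epsilon> + L * norm (u (s + \<tau>) - u s)"
        using that c by (intro order_trans[OF norm_triangle_ineq] add_mono S Lipschitz) auto
      also have "\<dots> \<le> \<epsilon> + L * b" using B[of s] that c L by (intro add_left_mono mult_left_mono) auto
      finally show ?thesis .
    qed
    have "eventually (\<lambda>t. M * norm x * exp (- \<omega> * (t - 0)) \<le> \<epsilon> \<and> norm x * M * exp (- \<omega> * (t - (- \<tau>))) \<le> \<epsilon>
        \<and> M * norm (conv 0 \<tau> g) * exp (- \<omega> * (t - 0)) \<le> \<epsilon> \<and> M * norm (conv 0 c \<Delta>) * exp (- \<omega> * (t - c)) \<le> \<epsilon>
        \<and> T \<le> t \<and> c \<le> t) at_top"
      by (intro eventually_conj exp_decay_eventually \<epsilon> eventually_ge_at_top)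
    then show ?thesis
    proof (rule eventually_mono, elim conjE)
      fix t
      assume t: "M * norm x * exp (- \<omega> * (t - 0)) \<le> \<epsilon>" "norm x * M * exp (- \<omega> * (t - (- \<tau>))) \<le> \<epsilon>"
        "M * norm (conv 0 \<tau> g) * exp (- \<omega> * (t - 0)) \<le> \<epsilon>" "M * norm (conv 0 c \<Delta>) * exp (- \<omega> * (t - c)) \<le> \<epsilon>"
        "T \<le> t" "c \<le> t"
      have t0: "0 \<le> t" using t c by simp
      have 1: "norm (U t 0 x) \<le> \<epsilon>" "norm (U (t + \<tau>) 0 x) \<le> \<epsilon>" "norm (U (t + \<tau>) \<tau> (conv 0 \<tau> g)) \<le> \<epsilon>"
        "norm (U t c (conv 0 c \<Delta>)) \<le> \<epsilon>"
        using apply_decay[of 0 t x] apply_decay[of 0 "t + \<tau>" x] apply_decay[of \<tau> "t + \<tau>" "conv 0 \<tau> g"]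
          apply_decay[of c t "conv 0 c \<Delta>"] t t0 \<tau>
        by (auto simp: mult_ac)
      have "G * integral {0..t} (shift_diff \<tau> t) \<le> G * \<epsilon>" using T t t0 G0 by (intro mult_left_mono) auto
      moreover have "norm (conv 0 t \<Delta>) \<le> norm (U t c (conv 0 c \<Delta>)) + norm (conv c t \<Delta>)"
        using conv_split[OF \<Delta>c, of 0 c t] c t norm_triangle_ineq[of "U t c (conv 0 c \<Delta>)" "conv c t \<Delta>"] by simp
      moreover have "norm (conv c t \<Delta>) \<le> M * (\<epsilon> + L * b) / \<omega>"
        using c t by (intro conv_le \<Delta>c \<Delta>2) auto
      moreover have "M * (\<epsilon> + L * b) / \<omega> = M / \<omega> * \<epsilon> + q * b"
        by (simp add: q_def distrib_left add_divide_distrib)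
      moreover have "norm (u (t + \<tau>) - u t) \<le> (norm (U (t + \<tau>) 0 x) + norm (U t 0 x)) + norm (conv 0 (t + \<tau>) g - conv 0 t g)"
      proof -
        have "u (t + \<tau>) - u t = (U (t + \<tau>) 0 x - U t 0 x) + (conv 0 (t + \<tau>) g - conv 0 t g)"
          using u'(2)[of t] u'(2)[of "t + \<tau>"] t0 \<tau> by simp
        then show ?thesis
          using norm_triangle_ineq[of "U (t + \<tau>) 0 x - U t 0 x" "conv 0 (t + \<tau>) g - conv 0 t g"]
            norm_triangle_ineq4[of "U (t + \<tau>) 0 x" "U t 0 x"] by simp
      qed
      moreover note shifted_difference[OF g \<tau> t0, folded \<Delta>_def]
      moreover have "e = G * \<epsilon> + 4 * \<epsilon> + M / \<omega> * \<epsilon>" by (simp add: e_def distrib_right)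
      ultimately show "norm (u (t + \<tau>) - u t) \<le> e + q * b" using 1 by linarith
    qed
  qed
  have e0: "0 \<le> e" using G0 pos \<epsilon> by (simp add: e_def)
  have iter: "eventually (\<lambda>t. norm (u (t + \<tau>) - u t) \<le> e / (1 - q) + q ^ n * (2 * R)) at_top" for n
  proof (induction n)
    case 0
    have "norm (u (t + \<tau>) - u t) \<le> e / (1 - q) + q ^ 0 * (2 * R)" if "0 \<le> t" for t
    proof -
      have "0 \<le> e / (1 - q)" using e0 q by simp
      then show ?thesis using norm_triangle_ineq4[of "u (t + \<tau>)" "u t"] R[of t] R[of "t + \<tau>"] that \<tau> by simp
    qed
    then show ?case unfolding eventually_at_top_linorder by blast
  next
    case (Suc n)
    have "0 \<le> e / (1 - q) + q ^ n * (2 * R)" using e0 q R0 by simp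
    from step[OF this Suc] show ?case
    proof (rule eventually_mono)
      have "e + q * (e / (1 - q) + q ^ n * (2 * R)) = e / (1 - q) + q ^ Suc n * (2 * R)"
        using q by (simp add: field_simps)
      then show "norm (u (t + \<tau>) - u t) \<le> e / (1 - q) + q ^ Suc n * (2 * R)"
        if "norm (u (t + \<tau>) - u t) \<le> e + q * (e / (1 - q) + q ^ n * (2 * R))" for t
        using that by simp
    qed
  qed
  have "(\<lambda>n. q ^ n * (2 * R)) \<longlonglongrightarrow> 0"
    using q by (intro tendsto_mult_left_zero LIMSEQ_power_zero) auto
  then have "eventually (\<lambda>n. q ^ n * (2 * R) < \<epsilon>) sequentially" using \<epsilon> by (rule order_tendstoD)
  \<comment> \<open>The threshold in t may grow with n, so n is fixed instead of passing to the
    limit; the summand 1 in the final constant absorbs the remainder.\<close>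
  then obtain n where n: "q ^ n * (2 * R) < \<epsilon>" using eventually_happens'[OF sequentially_bot] by blast
  from iter[of n] show ?thesis
  proof (rule eventually_mono)
    show "norm (u (t + \<tau>) - u t) \<le> ((G + 4 + M / \<omega>) / (1 - q) + 1) * \<epsilon>"
      if "norm (u (t + \<tau>) - u t) \<le> e / (1 - q) + q ^ n * (2 * R)" for t
      using that n by (simp add: e_def distrib_right)
  qed
qed

lemma mild_quasi_periods_dense:
  assumes u: "mild u" and \<epsilon>: "0 < \<epsilon>"
    and F_dense: "\<And>\<epsilon>. 0 < \<epsilon> \<Longrightarrow> \<exists>l>0. \<forall>a\<ge>0. \<exists>\<tau>\<in>{a..a + l}. F_period \<epsilon> \<tau>"
    and U_dense: "\<And>\<epsilon>. 0 < \<epsilon> \<Longrightarrow> \<exists>l>0. \<forall>a\<ge>0. \<exists>\<tau>\<in>{a..a + l}. quasi_period \<epsilon> \<tau>"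
  shows "\<exists>l>0. \<forall>a\<ge>0. \<exists>\<tau>\<in>{a..a + l}. \<exists>T>0. \<forall>t\<ge>0. T \<le> \<bar>t\<bar> \<longrightarrow> norm (u (t + \<tau>) - u t) \<le> \<epsilon>"
proof -
  have bounded: "bounded (u ` {0..})" using u unfolding mild_def by blast
  then obtain R where "\<forall>t\<in>{0..}. norm (u t) \<le> R" unfolding bounded_iff by blast
  then have R: "\<And>t. 0 \<le> t \<Longrightarrow> norm (u t) \<le> R" by simp
  obtain G where G: "\<And>t. 0 \<le> t \<Longrightarrow> norm (F t (u t)) \<le> G"
    by (rule F_comp_bounded[OF bounded]) blast
  have G0: "0 \<le> G" using G[of 0] by (auto intro: order_trans[OF norm_ge_zero])
  define C where "C = (G + 4 + M / \<omega>) / (1 - q) + 1"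
  have "0 \<le> (G + 4 + M / \<omega>) / (1 - q)" using G0 q pos by (intro divide_nonneg_pos) auto
  then have C: "0 < C" by (simp add: C_def)
  define \<delta> where "\<delta> = \<epsilon> / C / 3"
  have \<delta>: "0 < \<delta>" "C * (3 * \<delta>) = \<epsilon>" using C \<epsilon> by (auto simp: \<delta>_def)
  from quasi_period_small[OF \<delta>(1)] obtain h where h: "0 < h" "\<And>\<tau>. \<bar>\<tau>\<bar> \<le> h \<Longrightarrow> quasi_period \<delta> \<tau>" by metis
  from F_dense[of "\<delta>"] \<delta> obtain l where l: "0 < l" "\<And>a. 0 \<le> a \<Longrightarrow> \<exists>\<tau>\<in>{a..a + l}. F_period \<delta> \<tau>" by metis
  from U_dense[of "\<delta>"] \<delta> obtain l' where l': "0 < l'" "\<And>a. 0 \<le> a \<Longrightarrow> \<exists>\<tau>\<in>{a..a + l'}. quasi_period \<delta> \<tau>" by metis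
  from relatively_dense_differences[OF l l' h(1)] obtain N where N: "0 < N"
    "\<forall>a\<ge>0. \<exists>\<tau>\<^sub>1 \<tau>\<^sub>2 \<sigma>\<^sub>1 \<sigma>\<^sub>2. F_period \<delta> \<tau>\<^sub>1 \<and> F_period \<delta> \<tau>\<^sub>2 \<and> quasi_period \<delta> \<sigma>\<^sub>1 \<and> quasi_period \<delta> \<sigma>\<^sub>2 \<and>
      \<tau>\<^sub>1 - \<tau>\<^sub>2 \<in> {a..a + N} \<and> \<bar>(\<tau>\<^sub>1 - \<tau>\<^sub>2) - (\<sigma>\<^sub>1 - \<sigma>\<^sub>2)\<bar> \<le> h" by blast
  show ?thesis
  proof (rule exI[of _ N], intro conjI allI impI N(1))
    fix a :: real assume a: "0 \<le> a"
    with N(2) obtain \<tau>\<^sub>1 \<tau>\<^sub>2 \<sigma>\<^sub>1 \<sigma>\<^sub>2 where p: "F_period \<delta> \<tau>\<^sub>1" "F_period \<delta> \<tau>\<^sub>2" "quasi_period \<delta> \<sigma>\<^sub>1" "quasi_period \<delta> \<sigma>\<^sub>2"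
      and \<tau>: "\<tau>\<^sub>1 - \<tau>\<^sub>2 \<in> {a..a + N}" and near: "\<bar>(\<tau>\<^sub>1 - \<tau>\<^sub>2) - (\<sigma>\<^sub>1 - \<sigma>\<^sub>2)\<bar> \<le> h" by blast
    define \<tau> where "\<tau> = \<tau>\<^sub>1 - \<tau>\<^sub>2"
    \<comment> \<open>\<tau> is written as a difference of quasi-periods of U minus a number of size
      at most h, itself a quasi-period by \<open>quasi_period_small\<close>.\<close>
    have "quasi_period (\<delta> + \<delta> + \<delta>) ((\<sigma>\<^sub>1 - \<sigma>\<^sub>2) - ((\<sigma>\<^sub>1 - \<sigma>\<^sub>2) - \<tau>))"
      by (intro quasi_period_diff p h(2)) (use near in \<open>auto simp: \<tau>_def\<close>)
    then have qp: "quasi_period (3 * \<delta>) \<tau>" by simp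
    have "F_period (\<delta> + \<delta>) \<tau>" unfolding \<tau>_def by (intro F_period_diff p)
    then have fp: "F_period (3 * \<delta>) \<tau>" by (rule F_period_mono) (use \<delta> in simp)
    have "0 \<le> \<tau>" using \<tau> a by (simp add: \<tau>_def)
    from mild_quasi_period[OF u R G _ this qp fp] \<delta>
    obtain T where T: "\<And>t. T \<le> t \<Longrightarrow> norm (u (t + \<tau>) - u t) \<le> \<epsilon>"
      unfolding eventually_at_top_linorder C_def[symmetric] by auto
    show "\<exists>\<tau>\<in>{a..a + N}. \<exists>T>0. \<forall>t\<ge>0. T \<le> \<bar>t\<bar> \<longrightarrow> norm (u (t + \<tau>) - u t) \<le> \<epsilon>"
      using \<tau> T by (intro bexI[of _ \<tau>] exI[of _ "max T 1"]) (auto simp: \<tau>_def)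
  qed
qed

end

section \<open>Acquistapace--Terreni operators\<close>

lemma of_real_in_closure_sector:
  assumes "0 < \<phi>" "0 \<le> l"
  shows "complex_of_real l \<in> closure (sector \<phi>)"
proof -
  have pos: "complex_of_real r \<in> sector \<phi>" if "0 < r" for r
    using that assms by (simp add: sector_def Arg_of_real)
  show ?thesis
  proof (cases "l = 0")
    case True
    have "\<exists>y\<in>sector \<phi>. dist y 0 < e" if "0 < e" for e
      using pos[of "e / 2"] that by (intro bexI[of _ "complex_of_real (e / 2)"]) auto
    then show ?thesis by (simp add: True closure_approachable)
  next
    case False
    then show ?thesis using pos[of l] assms closure_subset by auto
  qed
qed

lemma shifted_pencil:
  "z *\<^sub>C x - shifted A w x = (z + complex_of_real w) *\<^sub>C x - A x"
  by (simp add: shifted_def scaleC_add_left)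

lemma resolvent_shifted: "resolvent D (shifted A w) z = resolvent D A (z + complex_of_real w)"
  by (simp add: resolvent_def shifted_pencil)

lemma resolvent_set_shifted: "z \<in> resolvent_set D (shifted A w) \<longleftrightarrow> z + complex_of_real w \<in> resolvent_set D A"
  by (simp add: resolvent_set_def shifted_pencil resolvent_shifted)

lemma resolvent_set_resolvent:
  assumes "z \<in> resolvent_set D A"
  shows "bounded_linear (resolvent D A z)" "resolvent D A z x \<in> D"
    "z *\<^sub>C resolvent D A z x - A (resolvent D A z x) = x"
    "y \<in> D \<Longrightarrow> resolvent D A z (z *\<^sub>C y - A y) = y"
proof -
  have bij: "bij_betw (\<lambda>x. z *\<^sub>C x - A x) D UNIV" and bl: "bounded_linear (resolvent D A z)"
    using assms by (auto simp: resolvent_set_def)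
  show "bounded_linear (resolvent D A z)" by (fact bl)
  have im: "x \<in> (\<lambda>x. z *\<^sub>C x - A x) ` D" using bij by (simp add: bij_betw_def)
  show "resolvent D A z x \<in> D"
    unfolding resolvent_def using im by (rule inv_into_into)
  show "z *\<^sub>C resolvent D A z x - A (resolvent D A z x) = x"
    unfolding resolvent_def using f_inv_into_f[OF im] by simp
  show "resolvent D A z (z *\<^sub>C y - A y) = y" if "y \<in> D"
    unfolding resolvent_def using bij that by (intro inv_into_f_f) (auto simp: bij_betw_def)
qed

text \<open>The sector conditions are restricted to real l \<ge> 0, including the boundary point 0,
  where the resolvent of the shifted operator is that of A(t) at w. \<open>generated_by\<close>
  bounds U over time steps up to 1 only; \<open>U_bound\<close> supplies the rest.\<close>

lemma acquistapace_terreni_parabolic: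
  assumes AT: "acquistapace_terreni D A w \<phi> \<mu> \<nu>" and ev: "evolution_system U" and gen: "generated_by U D A"
    and U_bound: "\<And>t s. s \<le> t \<Longrightarrow> norm (U t s) \<le> M'"
  shows "\<exists>AU R K M. parabolic_evolution D (\<lambda>t. shifted (A t) w) U AU R w \<mu> \<nu> K M"
proof -
  define B where "B t = shifted (A t) w" for t
  define R where "R l t = resolvent (D t) (B t) (complex_of_real l)" for l t
  have exps: "0 \<le> w" "pi / 2 < \<phi>" "0 < \<mu>" "\<mu> \<le> 1" "0 < \<nu>" "\<nu> \<le> 1" "1 < \<mu> + \<nu>"
    and res: "closure (sector \<phi>) \<subseteq> resolvent_set (D t) (B t)" for t
    using AT by (auto simp: acquistapace_terreni_def B_def)
  have "0 < \<phi>" using exps(2) pi_gt_zero by linarith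
  then have sec: "complex_of_real l \<in> closure (sector \<phi>)" if "0 \<le> l" for l
    using that by (rule of_real_in_closure_sector)
  then have rs: "complex_of_real l \<in> resolvent_set (D t) (B t)" if "0 \<le> l" for l t
    using res that by blast
  have R0: "resolvent (D t) (A t) (complex_of_real w) = R 0 t" for t
    by (simp add: R_def B_def resolvent_shifted)
  from AT obtain K1 where K1: "\<And>t z. z \<in> closure (sector \<phi>) \<Longrightarrow> onorm (resolvent (D t) (B t) z) \<le> K1 / (1 + cmod z)"
    unfolding acquistapace_terreni_def B_def by blast
  from AT obtain K2 where K2: "\<And>t s z. z \<in> closure (sector \<phi>) - {0} \<Longrightarrow>
      onorm (\<lambda>x. B t (resolvent (D t) (B t) z (R 0 t x - R 0 s x))) \<le> K2 * \<bar>t - s\<bar> powr \<mu> * cmod z powr (- \<nu>)"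
    unfolding acquistapace_terreni_def B_def[symmetric] R0 by blast
  from gen obtain AU :: "real \<Rightarrow> real \<Rightarrow> 'a \<Rightarrow>\<^sub>L 'a" and C where
    AU: "\<And>t s x. s < t \<Longrightarrow> AU t s x = A t (U t s x)"
      "\<And>t s. s < t \<Longrightarrow> ((\<lambda>r. U r s) has_vector_derivative AU t s) (at t)"
      "\<And>t s. s < t \<and> t \<le> s + 1 \<Longrightarrow> norm (U t s) \<le> C \<and> norm (AU t s) \<le> C / (t - s)"
    unfolding generated_by_def by blast
  define K where "K = max 1 (max K1 K2)"
  define M where "M = max 1 (max M' C)"
  have K: "1 \<le> K" "K1 \<le> K" "K2 \<le> K" and M: "1 \<le> M" "M' \<le> M" "C \<le> M" by (auto simp: K_def M_def)
  have R_linear: "bounded_linear (R l t)" if "0 \<le> l" for l t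
    unfolding R_def by (rule resolvent_set_resolvent[OF rs[OF that]])
  have R_right: "l *\<^sub>R R l t x - B t (R l t x) = x" if "0 \<le> l" for l t x
    unfolding R_def scaleR_scaleC by (rule resolvent_set_resolvent[OF rs[OF that]])
  have "parabolic_evolution D B U AU R w \<mu> \<nu> K M"
  proof (rule parabolic_evolution.intro)
    show "0 < \<mu>" "\<mu> \<le> 1" "0 < \<nu>" "\<nu> \<le> 1" "1 < \<mu> + \<nu>" "0 \<le> w" "1 \<le> K" "1 \<le> M"
      using exps K M by auto
    show "U s s = id_blinfun" for s using ev by (simp add: evolution_system_def)
    show "U t s = U t r o\<^sub>L U r s" if "s \<le> r" "r \<le> t" for t r s
      using ev that by (simp add: evolution_system_def)
    show "U t s x \<in> D t" if "s < t" for s t x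
      using gen that unfolding generated_by_def by blast
    show "((\<lambda>r. U r s) has_vector_derivative AU t s) (at t)" if "s < t" for s t
      using that by (rule AU)
    show "AU t s x = B t (U t s x) + w *\<^sub>R U t s x" if "s < t" for s t x
      using that by (simp add: AU(1) B_def shifted_def scaleR_scaleC)
    show "norm (U t s) \<le> M" if "s \<le> t" for s t using U_bound[OF that] M by simp
    show "norm (AU t s) \<le> M / (t - s)" if "s < t" "t \<le> s + 1" for s t
    proof -
      have "norm (AU t s) \<le> C / (t - s)" using AU(3) that by blast
      also have "\<dots> \<le> M / (t - s)" using M that by (intro divide_right_mono) auto
      finally show ?thesis .
    qed
    show "((\<lambda>t. R l s (U t s x)) \<longlongrightarrow> R l s x) (at_right s)" if "0 \<le> l" for l s x
      using gen rs[OF that, of s]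
      unfolding generated_by_def R_def B_def resolvent_shifted resolvent_set_shifted by blast
    show "bounded_linear (R l t)" if "0 \<le> l" for l t using that by (rule R_linear)
    show "l *\<^sub>R R l t x - B t (R l t x) = x" if "0 \<le> l" for l t x using that by (rule R_right)
    show "R l t x \<in> D t" if "0 \<le> l" for l t x
      unfolding R_def by (rule resolvent_set_resolvent[OF rs[OF that]])
    show "R l t (l *\<^sub>R x - B t x) = x" if "0 \<le> l" "x \<in> D t" for l t x
      unfolding R_def scaleR_scaleC by (rule resolvent_set_resolvent(4)[OF rs[OF that(1)] that(2)])
    show "norm (R l t x) \<le> K / (1 + l) * norm x" if l: "0 \<le> l" for l t x
    proof -
      have "norm (R l t x) \<le> onorm (R l t) * norm x" by (rule onorm[OF R_linear[OF l]])
      also have "onorm (R l t) \<le> K1 / (1 + l)"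
        unfolding R_def using K1[OF sec[OF l], of t] l by simp
      also have "\<dots> \<le> K / (1 + l)" using K l by (intro divide_right_mono) auto
      finally show ?thesis by (simp add: mult_right_mono)
    qed
  next
    fix l t s x assume l: "0 < (l::real)"
    let ?f = "\<lambda>x. B t (R l t (R 0 t x - R 0 s x))"
    \<comment> \<open>In this form the operator is visibly bounded, which is what allows a pointwise
      estimate to be read off from \<open>onorm\<close>.\<close>
    have "?f = (\<lambda>x. l *\<^sub>R R l t (R 0 t x - R 0 s x) - (R 0 t x - R 0 s x))"
      using R_right[of l t] l by (auto simp: fun_eq_iff algebra_simps)
    moreover have "bounded_linear \<dots>"
      using l by (intro bounded_linear_sub bounded_linear_scaleR_right[THEN bounded_linear_compose]
          R_linear[THEN bounded_linear_compose] R_linear) auto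
    ultimately have "norm (?f x) \<le> onorm ?f * norm x" by (intro onorm) simp
    also have "onorm ?f \<le> K2 * \<bar>t - s\<bar> powr \<mu> * l powr (- \<nu>)"
      using K2[of "complex_of_real l" t s] sec[of l] l by (simp add: R_def)
    also have "\<dots> \<le> K * \<bar>t - s\<bar> powr \<mu> * l powr (- \<nu>)" using K by (intro mult_right_mono) auto
    finally show "norm (?f x) \<le> K * \<bar>t - s\<bar> powr \<mu> * l powr (- \<nu>) * norm x"
      by (simp add: mult_right_mono)
  qed
  then show ?thesis unfolding B_def by blast
qed

theorem theorem4p6:
  fixes D :: "real \<Rightarrow> 'a::complex_banach set"
    and A :: "real \<Rightarrow> 'a \<Rightarrow> 'a"
    and U :: "real \<Rightarrow> real \<Rightarrow> 'a \<Rightarrow>\<^sub>L 'a"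
    and P :: "real \<Rightarrow> 'a \<Rightarrow>\<^sub>L 'a"
    and F :: "real \<Rightarrow> 'a \<Rightarrow> 'a"
    and x :: 'a
    and \<omega>\<^sub>0 \<phi> \<mu> \<nu> M' \<omega> L :: real
  assumes nontrivial: "\<exists>z::'a. z \<noteq> 0"
    and closed: "\<And>t. closed_linear_operator (D t) (A t)"
    and H1: "acquistapace_terreni D A \<omega>\<^sub>0 \<phi> \<mu> \<nu>"
    and evolution: "evolution_system U"
    and generated: "generated_by U D A"
    and H2: "hyperbolic U P M' \<omega>"
    and exponentially_stable: "\<And>t. P t = id_blinfun"
    and x: "x \<in> range (P 0) \<inter> closure (D 0)"
    and F: "F \<in> QAAP2"
    and F_bounded: "bounded ((\<lambda>t. F t 0) ` {0..})"
    and Green: "\<forall>\<epsilon>>0. \<exists>l>0. \<forall>a\<ge>0. \<exists>\<tau>\<in>{a..a + l}. \<exists>M>0. \<forall>t\<ge>M.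
       (\<integral>\<^sup>+ s\<in>{0..}. ennreal (onorm (\<lambda>y. green U P (t + \<tau>) (t + \<tau> - s) y
                                  - green U P t (t - s) y)) \<partial>lborel) \<le> ennreal \<epsilon>"
    and L: "0 < L" "L < \<omega> / M'"
    and Lipschitz: "\<And>t y z. 0 \<le> t \<Longrightarrow> norm (F t y - F t z) \<le> L * norm (y - z)"
  shows "\<exists>!u. u \<in> extensional {0..} \<and> mild_solution U F x u \<and> u \<in> QAAP"
proof -
  have pos: "0 < M'" "0 < \<omega>" using H2 by (auto simp: hyperbolic_def)
  have "norm (U t s o\<^sub>L P s) \<le> M' * exp (- \<omega> * (t - s))" if "s \<le> t" for t s
    using H2 that unfolding hyperbolic_def by blast
  moreover have "U t s o\<^sub>L P s = U t s" for t s
    by (rule blinfun_eqI) (simp add: exponentially_stable)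
  ultimately have decay: "norm (U t s) \<le> M' * exp (- \<omega> * (t - s))" if "s \<le> t" for t s
    using that by simp
  have "norm (U t s) \<le> M'" if "s \<le> t" for t s
    using decay[OF that] mult_left_mono[of "exp (- \<omega> * (t - s))" 1 M'] pos that
    by (auto intro: order_trans)
  from acquistapace_terreni_parabolic[OF H1 evolution generated this]
  obtain AU R K M where "parabolic_evolution D (\<lambda>t. shifted (A t) \<omega>\<^sub>0) U AU R \<omega>\<^sub>0 \<mu> \<nu> K M" by blast
  then interpret parabolic: parabolic_evolution D "\<lambda>t. shifted (A t) \<omega>\<^sub>0" U AU R \<omega>\<^sub>0 \<mu> \<nu> K M .
  interpret semilinear_evolution U M' \<omega> F x L
  proof
    show "((\<lambda>t. U t 0 x) \<longlongrightarrow> x) (at_right 0)"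
      using generated x unfolding generated_by_def by blast
    show "continuous_on ({0..} \<times> UNIV) (\<lambda>(t, x). F t x)"
      using F by (simp add: QAAP2_def)
  qed (fact pos decay parabolic.U_refl parabolic.U_trans parabolic.U_left_uniform parabolic.U_right_uniform
      F_bounded L Lipschitz)+
  have mild_solution_iff: "mild_solution U F x u \<longleftrightarrow> mild u" for u
  proof -
    have "(\<lambda>s. U t s (F s (u s))) integrable_on {0..t}" if "continuous_on {0..} u" for t
      by (intro conv_integrable continuous_on_subset[OF F_comp_continuous[OF that]]) auto
    then show ?thesis by (auto simp: mild_solution_def mild_def conv_def)
  qed
  have F_dense: "\<exists>l>0. \<forall>a\<ge>0. \<exists>\<tau>\<in>{a..a + l}. F_period \<epsilon> \<tau>" if "0 < \<epsilon>" for \<epsilon>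
  proof -
    from F that obtain l where l: "0 < l" "\<And>a. 0 \<le> a \<Longrightarrow> \<exists>\<tau>\<in>{a..a + l}. \<exists>T>0. \<forall>B. bounded B \<longrightarrow>
        (\<forall>t\<ge>0. \<forall>y\<in>B. \<bar>t\<bar> \<ge> T \<longrightarrow> norm (F (t + \<tau>) y - F t y) \<le> \<epsilon>)"
      unfolding QAAP2_def by blast
    \<comment> \<open>Singletons B = {y} suffice, since T does not depend on B.\<close>
    have "F_period \<epsilon> \<tau>"
      if "0 < T" "\<forall>B. bounded B \<longrightarrow> (\<forall>t\<ge>0. \<forall>y\<in>B. \<bar>t\<bar> \<ge> T \<longrightarrow> norm (F (t + \<tau>) y - F t y) \<le> \<epsilon>)" for \<tau> T
      unfolding F_period_def
    proof (intro exI[of _ T] allI impI)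
      fix t y assume "T \<le> t"
      then show "norm (F (t + \<tau>) y - F t y) \<le> \<epsilon>" using that(1) that(2)[rule_format, of "{y}" t y] by simp
    qed
    then show ?thesis using l by meson
  qed
  have U_dense: "\<exists>l>0. \<forall>a\<ge>0. \<exists>\<tau>\<in>{a..a + l}. quasi_period \<epsilon> \<tau>" if \<epsilon>: "0 < \<epsilon>" for \<epsilon>
  proof -
    let ?N = "\<lambda>\<tau> t. \<integral>\<^sup>+ s\<in>{0..}. ennreal (onorm (\<lambda>y. green U P (t + \<tau>) (t + \<tau> - s) y
                                  - green U P t (t - s) y)) \<partial>lborel"
    have "integral {0..r} (shift_diff \<tau> t) \<le> \<epsilon>" if N: "?N \<tau> t \<le> ennreal \<epsilon>" for \<tau> t r
    proof -
      have "ennreal (integral {0..r} (shift_diff \<tau> t)) =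
          (\<integral>\<^sup>+ s\<in>{0..r}. ennreal (shift_diff \<tau> t s) \<partial>lborel)"
        by (intro nn_integral_has_integral_lebesgue'[symmetric] integrable_integral integrable_shift_diff shift_diff_nonneg)
      also have "\<dots> \<le> ?N \<tau> t"
      proof (rule nn_integral_mono)
        fix s
        \<comment> \<open>For s \<ge> 0 both Green's functions are evaluated in the branch where
          they equal U, as P is the identity.\<close>
        have "shift_diff \<tau> t s = onorm (\<lambda>y. green U P (t + \<tau>) (t + \<tau> - s) y - green U P t (t - s) y)" if "0 \<le> s"
          using that
          by (simp add: green_def exponentially_stable shift_diff_def norm_blinfun.rep_eq blinfun.diff_left[abs_def])
        then show "ennreal (shift_diff \<tau> t s) * indicator {0..r} s \<le>
            ennreal (onorm (\<lambda>y. green U P (t + \<tau>) (t + \<tau> - s) y - green U P t (t - s) y)) * indicator {0..} s"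
          by (auto simp: indicator_def)
      qed
      finally show ?thesis using N \<epsilon> by (meson ennreal_le_iff less_imp_le order.trans)
    qed
    then have "quasi_period \<epsilon> \<tau>" if "\<forall>t\<ge>T. ?N \<tau> t \<le> ennreal \<epsilon>" for \<tau> T
      unfolding quasi_period_def using that by blast
    then show ?thesis using Green[rule_format, OF \<epsilon>] by meson
  qed
  have QAAP: "u \<in> QAAP" if "mild u" for u
    using mild_quasi_periods_dense[OF that _ F_dense U_dense] that by (auto simp: QAAP_def mild_def)
  from mild_exists obtain u where u: "mild u" by blast
  \<comment> \<open>Cutting off at negative times selects the one extensional representative, which
    makes uniqueness an equality of functions.\<close>
  have mild_u: "mild (restrict u {0..})"
  proof -
    have conv: "conv 0 t (\<lambda>s. F s (restrict u {0..} s)) = conv 0 t (\<lambda>s. F s (u s))" for t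
      unfolding conv_def by (intro integral_cong) simp
    have "continuous_on {0..} (restrict u {0..})"
      by (rule continuous_on_eq[of _ u]) (use u in \<open>auto simp: mild_def\<close>)
    moreover have "restrict u {0..} ` {0..} = u ` {0..}" by (auto intro!: image_cong)
    then have "bounded (restrict u {0..} ` {0..})" using u unfolding mild_def by metis
    moreover have "\<forall>t\<ge>0. restrict u {0..} t = U t 0 x + conv 0 t (\<lambda>s. F s (restrict u {0..} s))"
      using u unfolding mild_def conv by simp
    ultimately show ?thesis unfolding mild_def by blast
  qed
  show ?thesis
  proof (rule ex1I[of _ "restrict u {0..}"])
    show "restrict u {0..} \<in> extensional {0..} \<and> mild_solution U F x (restrict u {0..}) \<and> restrict u {0..} \<in> QAAP"
      using mild_u QAAP[OF mild_u] by (simp add: mild_solution_iff)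
    show "v = restrict u {0..}" if "v \<in> extensional {0..} \<and> mild_solution U F x v \<and> v \<in> QAAP" for v
      using that mild_unique[of v "restrict u {0..}"] mild_u
      by (intro extensionalityI[of v "{0..}"]) (auto simp: mild_solution_iff)
  qed
qed

end
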